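(* If $X$ is a Corson compactum, then its countable uniform power $\prod_u^{\omega} X$ is collectionwise normal, countably paracompact and Fréchet-Urysohn.
   Context: All spaces are Tychonoff (completely regular Hausdorff); a compactum is a compact (Hausdorff) space. For a cardinal $\kappa$ and $I=[0,1]$, let $\mathrm{supp}(x)=\{\alpha<\kappa:x(\alpha)\neq0\}$ for $x\in{}^{\kappa}I$, and $\Sigma\,{}^{\kappa}I=\{x\in{}^{\kappa}I:|\mathrm{supp}(x)|\le\omega\}$ with the subspace topology from the Tychonoff power ${}^\kappa I$. A Corson compactum is a compactum that is contained (embedded) in some such $\Sigma$-product of copies of the unit interval. Countable uniform power: let $X$ be compact and let $\mathfrak{U}$ be its unique compatible uniformity. For $U\in\mathfrak{U}$ let $\widetilde U=\{\langle f,g\rangle: f,g\in {}^{\omega}X,\ \forall n<\omega\ \langle f(n),g(n)\rangle\in U\}$. The sets $\widetilde U$, $U\in\mathfrak{U}$, form a base of a uniformity on ${}^{\omega}X$, and $\prod_u^{\omega}X$ is the set ${}^{\omega}X$ with the topology generated by this uniformity. *)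

theory Defs
  imports "HOL-Analysis.Analysis"
begin

section \<open>Corson compacta\<close>

definition Sigma_product_interval :: "'k set \<Rightarrow> ('k \<Rightarrow> real) topology" where
  "Sigma_product_interval K =
     subtopology (product_topology (\<lambda>_. top_of_set {0..1}) K)
       {x. countable {\<alpha> \<in> K. x \<alpha> \<noteq> 0}}"

text \<open>HOL cannot quantify over types inside a formula, so the type from which the index set
  (the cardinal) is taken is a parameter; a statement polymorphic in it covers all cardinals.\<close>

definition Corson_compactum :: "'k itself \<Rightarrow> 'a topology \<Rightarrow> bool" where
  "Corson_compactum (T :: 'k itself) X \<longleftrightarrow>
     compact_space X \<and> Hausdorff_space X \<and>
     (\<exists>(K :: 'k set) f. embedding_map X (Sigma_product_interval K) f)"


section \<open>Uniformities on a set\<close>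

definition is_uniformity_on :: "'a set \<Rightarrow> ('a \<times> 'a) set set \<Rightarrow> bool" where
  "is_uniformity_on S \<U> \<longleftrightarrow>
     \<U> \<noteq> {} \<and>
     (\<forall>U\<in>\<U>. Id_on S \<subseteq> U \<and> U \<subseteq> S \<times> S) \<and>
     (\<forall>U\<in>\<U>. \<forall>V. U \<subseteq> V \<and> V \<subseteq> S \<times> S \<longrightarrow> V \<in> \<U>) \<and>
     (\<forall>U\<in>\<U>. \<forall>V\<in>\<U>. U \<inter> V \<in> \<U>) \<and>
     (\<forall>U\<in>\<U>. U\<inverse> \<in> \<U>) \<and>
     (\<forall>U\<in>\<U>. \<exists>V\<in>\<U>. V O V \<subseteq> U)"

lemma is_uniformity_onD:
  assumes "is_uniformity_on S \<U>"
  shows "\<exists>U. U \<in> \<U>"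
    and "U \<in> \<U> \<Longrightarrow> Id_on S \<subseteq> U"
    and "U \<in> \<U> \<Longrightarrow> U \<subseteq> S \<times> S"
    and "U \<in> \<U> \<Longrightarrow> U \<subseteq> V \<Longrightarrow> V \<subseteq> S \<times> S \<Longrightarrow> V \<in> \<U>"
    and "U \<in> \<U> \<Longrightarrow> V \<in> \<U> \<Longrightarrow> U \<inter> V \<in> \<U>"
    and "U \<in> \<U> \<Longrightarrow> U\<inverse> \<in> \<U>"
    and "U \<in> \<U> \<Longrightarrow> \<exists>V\<in>\<U>. V O V \<subseteq> U"
proof -
  note d1 = assms[unfolded is_uniformity_on_def]
  note d2 = d1[THEN conjunct2] note d3 = d2[THEN conjunct2] note d4 = d3[THEN conjunct2]
  note d5 = d4[THEN conjunct2] note d6 = d5[THEN conjunct2]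
  show "\<exists>U. U \<in> \<U>" using d1[THEN conjunct1] by (rule ex_in_conv[THEN iffD2])
  show "Id_on S \<subseteq> U" if "U \<in> \<U>"
    using d2[THEN conjunct1, THEN bspec, OF that] by (rule conjunct1)
  show "U \<subseteq> S \<times> S" if "U \<in> \<U>"
    using d2[THEN conjunct1, THEN bspec, OF that] by (rule conjunct2)
  show "V \<in> \<U>" if "U \<in> \<U>" "U \<subseteq> V" "V \<subseteq> S \<times> S"
    using d3[THEN conjunct1, THEN bspec, OF that(1), THEN spec, THEN mp, OF conjI, OF that(2,3)] .
  show "U \<inter> V \<in> \<U>" if "U \<in> \<U>" "V \<in> \<U>"
    using d4[THEN conjunct1, THEN bspec, OF that(1), THEN bspec, OF that(2)] .
  show "U\<inverse> \<in> \<U>" if "U \<in> \<U>"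
    using d5[THEN conjunct1, THEN bspec, OF that] .
  show "\<exists>V\<in>\<U>. V O V \<subseteq> U" if "U \<in> \<U>"
    using d6[THEN bspec, OF that] .
qed

lemma is_uniformity_onI:
  assumes "\<U> \<noteq> {}"
    and "\<And>U. U \<in> \<U> \<Longrightarrow> Id_on S \<subseteq> U"
    and "\<And>U. U \<in> \<U> \<Longrightarrow> U \<subseteq> S \<times> S"
    and "\<And>U V. U \<in> \<U> \<Longrightarrow> U \<subseteq> V \<Longrightarrow> V \<subseteq> S \<times> S \<Longrightarrow> V \<in> \<U>"
    and "\<And>U V. U \<in> \<U> \<Longrightarrow> V \<in> \<U> \<Longrightarrow> U \<inter> V \<in> \<U>"
    and "\<And>U. U \<in> \<U> \<Longrightarrow> U\<inverse> \<in> \<U>"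
    and "\<And>U. U \<in> \<U> \<Longrightarrow> \<exists>V\<in>\<U>. V O V \<subseteq> U"
  shows "is_uniformity_on S \<U>"
  unfolding is_uniformity_on_def
  by (intro conjI ballI allI impI; (elim conjE)?; rule assms; assumption)

lemma is_uniformity_on_half:
  assumes "is_uniformity_on S \<U>" and "U \<in> \<U>"
  obtains V where "V \<in> \<U>" "V O V \<subseteq> U"
proof -
  obtain V where "V \<in> \<U>" "V O V \<subseteq> U"
    using is_uniformity_onD(7)[OF assms] by (rule bexE)
  then show ?thesis by (rule that)
qed

lemma is_uniformity_on_sym:
  assumes "is_uniformity_on S \<U>" and "U \<in> \<U>"
  shows "U \<inter> U\<inverse> \<in> \<U>"
  by (rule is_uniformity_onD(5)[OF assms is_uniformity_onD(6)[OF assms]])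

definition uniformity_from_base :: "'a set \<Rightarrow> ('a \<times> 'a) set set \<Rightarrow> ('a \<times> 'a) set set" where
  "uniformity_from_base S \<B> = {W. W \<subseteq> S \<times> S \<and> (\<exists>U\<in>\<B>. U \<subseteq> W)}"

definition uniform_topology :: "'a set \<Rightarrow> ('a \<times> 'a) set set \<Rightarrow> 'a topology" where
  "uniform_topology S \<U> =
     topology (\<lambda>G. G \<subseteq> S \<and> (\<forall>x\<in>G. \<exists>U\<in>\<U>. U `` {x} \<subseteq> G))"

lemma openin_uniform_topology:
  assumes "is_uniformity_on S \<U>"
  shows "openin (uniform_topology S \<U>) G \<longleftrightarrow>
           G \<subseteq> S \<and> (\<forall>x\<in>G. \<exists>U\<in>\<U>. U `` {x} \<subseteq> G)"
proof -
  have "istopology (\<lambda>G. G \<subseteq> S \<and> (\<forall>x\<in>G. \<exists>U\<in>\<U>. U `` {x} \<subseteq> G))" (is "istopology ?P")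
    unfolding istopology_def
  proof (intro conjI allI impI)
    fix G H assume GH: "?P G" "?P H"
    have "\<exists>U\<in>\<U>. U `` {x} \<subseteq> G \<inter> H" if "x \<in> G \<inter> H" for x
    proof -
      have x: "x \<in> G" "x \<in> H" using that by simp_all
      obtain U where U: "U \<in> \<U>" "U `` {x} \<subseteq> G"
        using GH(1)[THEN conjunct2, THEN bspec, OF x(1)] by (rule bexE)
      obtain V where V: "V \<in> \<U>" "V `` {x} \<subseteq> H"
        using GH(2)[THEN conjunct2, THEN bspec, OF x(2)] by (rule bexE)
      have "U \<inter> V \<in> \<U>"
        using U(1) V(1) by (rule is_uniformity_onD(5)[OF assms])
      moreover have "(U \<inter> V) `` {x} \<subseteq> G \<inter> H"
        using U(2) V(2) by (auto simp: Image_singleton)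
      ultimately show ?thesis by (rule bexI[rotated])
    qed
    then show "\<forall>x\<in>G \<inter> H. \<exists>U\<in>\<U>. U `` {x} \<subseteq> G \<inter> H" by (rule ballI)
    show "G \<inter> H \<subseteq> S" using GH(1)[THEN conjunct1] by (rule le_infI1)
  next
    fix \<K> assume "\<forall>G\<in>\<K>. ?P G"
    have P: "?P G" if "G \<in> \<K>" for G
      using \<open>\<forall>G\<in>\<K>. ?P G\<close> that by (rule bspec)
    show "\<Union>\<K> \<subseteq> S" using P[THEN conjunct1] by (rule Union_least)
    show "\<forall>x\<in>\<Union>\<K>. \<exists>U\<in>\<U>. U `` {x} \<subseteq> \<Union>\<K>"
    proof
      fix x assume "x \<in> \<Union>\<K>"
      then obtain G where G: "G \<in> \<K>" "x \<in> G" by (rule UnionE)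
      obtain U where U: "U \<in> \<U>" "U `` {x} \<subseteq> G"
        using P[OF G(1), THEN conjunct2, THEN bspec, OF G(2)] by (rule bexE)
      have "U `` {x} \<subseteq> \<Union>\<K>" using U(2) Union_upper[OF G(1)] by (rule subset_trans)
      then show "\<exists>U\<in>\<U>. U `` {x} \<subseteq> \<Union>\<K>" using U(1) by (rule bexI)
    qed
  qed
  then show ?thesis
    unfolding uniform_topology_def by (simp only: topology_inverse')
qed

lemma topspace_uniform_topology:
  assumes "is_uniformity_on S \<U>"
  shows "topspace (uniform_topology S \<U>) = S"
proof -
  have "openin (uniform_topology S \<U>) S"
    unfolding openin_uniform_topology[OF assms]
    using is_uniformity_onD(1,3)[OF assms] by blast
  moreover have "topspace (uniform_topology S \<U>) \<subseteq> S"
    using openin_topspace[of "uniform_topology S \<U>"]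
    unfolding openin_uniform_topology[OF assms] by (rule conjunct1)
  ultimately show ?thesis
    by (intro subset_antisym openin_subset)
qed

definition compact_uniformity :: "'a topology \<Rightarrow> ('a \<times> 'a) set set" where
  "compact_uniformity X =
     (THE \<U>. is_uniformity_on (topspace X) \<U> \<and> uniform_topology (topspace X) \<U> = X)"

lemma uniform_neighbourhood:
  assumes u: "is_uniformity_on S \<U>" and U: "U \<in> \<U>" and x: "x \<in> S"
  obtains G where "openin (uniform_topology S \<U>) G" "x \<in> G" "G \<subseteq> U `` {x}"
proof
  let ?G = "{y \<in> S. \<exists>W\<in>\<U>. W `` {y} \<subseteq> U `` {x}}"
  have refl: "(y, y) \<in> W" if "W \<in> \<U>" "y \<in> S" for W y
    using is_uniformity_onD(2)[OF u that(1)] that(2) by blast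
  have sub: "W \<subseteq> S \<times> S" if "W \<in> \<U>" for W
    using is_uniformity_onD(3)[OF u that] .
  have "\<exists>V\<in>\<U>. V `` {y} \<subseteq> ?G" if y: "y \<in> ?G" for y
  proof -
    obtain W where W: "W \<in> \<U>" "W `` {y} \<subseteq> U `` {x}" using y by blast
    obtain V where V: "V \<in> \<U>" "V O V \<subseteq> W"
      by (rule is_uniformity_on_half[OF u W(1)])
    have "z \<in> ?G" if "(y, z) \<in> V" for z
    proof -
      have "V `` {z} \<subseteq> U `` {x}" using V(2) W(2) that by blast
      then show ?thesis using V(1) sub[OF V(1)] that by blast
    qed
    then show ?thesis using V(1) by blast
  qed
  then show "openin (uniform_topology S \<U>) ?G"
    unfolding openin_uniform_topology[OF u] by blast
  show "x \<in> ?G" using U x by blast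
  show "?G \<subseteq> U `` {x}" using refl by blast
qed

definition diagonal_neighbourhoods :: "'a topology \<Rightarrow> ('a \<times> 'a) set set" where
  "diagonal_neighbourhoods X =
     {W. W \<subseteq> topspace X \<times> topspace X \<and>
         (\<exists>D. openin (prod_topology X X) D \<and> Id_on (topspace X) \<subseteq> D \<and> D \<subseteq> W)}"

lemma compatible_uniformity_eq:
  assumes c: "compact_space X"
    and u: "is_uniformity_on (topspace X) \<U>" and t: "uniform_topology (topspace X) \<U> = X"
  shows "\<U> = diagonal_neighbourhoods X"
proof (rule set_eqI, rule iffI)
  let ?S = "topspace X"
  fix U assume U: "U \<in> \<U>"
  have sub: "U \<subseteq> ?S \<times> ?S" using is_uniformity_onD(3)[OF u U] .
  obtain V0 where V0: "V0 \<in> \<U>" "V0 O V0 \<subseteq> U"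
    by (rule is_uniformity_on_half[OF u U])
  define V where "V = V0 \<inter> V0\<inverse>"
  have V: "V \<in> \<U>" unfolding V_def using is_uniformity_on_sym[OF u V0(1)] .
  have "\<exists>G. openin X G \<and> x \<in> G \<and> G \<subseteq> V `` {x}" if "x \<in> ?S" for x
    using uniform_neighbourhood[OF u V that] t by metis
  then obtain G where G: "\<And>x. x \<in> ?S \<Longrightarrow> openin X (G x) \<and> x \<in> G x \<and> G x \<subseteq> V `` {x}"
    by metis
  have "openin (prod_topology X X) (\<Union>x\<in>?S. G x \<times> G x)"
    using G by (intro openin_Union) (auto simp: openin_prod_Times_iff)
  moreover have "Id_on ?S \<subseteq> (\<Union>x\<in>?S. G x \<times> G x)" using G by auto
  moreover have "(\<Union>x\<in>?S. G x \<times> G x) \<subseteq> U"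
  proof clarify
    fix x y z assume "x \<in> ?S" "y \<in> G x" "z \<in> G x"
    then have "(y, x) \<in> V0" "(x, z) \<in> V0" using G unfolding V_def by blast+
    then show "(y, z) \<in> U" using V0(2) by blast
  qed
  ultimately show "U \<in> diagonal_neighbourhoods X"
    using sub unfolding diagonal_neighbourhoods_def by blast
next
  let ?S = "topspace X"
  fix W assume "W \<in> diagonal_neighbourhoods X"
  then obtain D where W: "W \<subseteq> ?S \<times> ?S" and D: "openin (prod_topology X X) D" "Id_on ?S \<subseteq> D" "D \<subseteq> W"
    unfolding diagonal_neighbourhoods_def by blast
  have Int_in: "\<Inter>\<F> \<in> \<U>" if "finite \<F>" "\<F> \<noteq> {}" "\<F> \<subseteq> \<U>" for \<F>
    using that by (induction rule: finite_ne_induct) (use is_uniformity_onD(5)[OF u] in auto)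
  have "\<exists>V G. V \<in> \<U> \<and> openin X G \<and> x \<in> G \<and> G \<subseteq> V `` {x} \<and> (V O V) `` {x} \<times> (V O V) `` {x} \<subseteq> D"
    if x: "x \<in> ?S" for x
  proof -
    have "(x, x) \<in> D" using D x by blast
    then obtain A B where AB: "openin X A" "openin X B" "x \<in> A" "x \<in> B" "A \<times> B \<subseteq> D"
      using D(1) unfolding openin_prod_topology_alt by meson
    have "openin X (A \<inter> B)" using AB by blast
    then obtain U where U: "U \<in> \<U>" "U `` {x} \<subseteq> A \<inter> B"
      using openin_uniform_topology[OF u] t AB by (metis IntI)
    obtain V where V: "V \<in> \<U>" "V O V \<subseteq> U"
      by (rule is_uniformity_on_half[OF u U(1)])
    obtain G where "openin X G" "x \<in> G" "G \<subseteq> V `` {x}"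
      using uniform_neighbourhood[OF u V(1) x] t by metis
    moreover have "(V O V) `` {x} \<times> (V O V) `` {x} \<subseteq> D" using V U AB by blast
    ultimately show ?thesis using V by blast
  qed
  then obtain V G where VG: "\<And>x. x \<in> ?S \<Longrightarrow> V x \<in> \<U> \<and> openin X (G x) \<and> x \<in> G x \<and>
      G x \<subseteq> V x `` {x} \<and> (V x O V x) `` {x} \<times> (V x O V x) `` {x} \<subseteq> D"
    by metis
  have refl: "(y, y) \<in> V x" if "x \<in> ?S" "y \<in> ?S" for x y
  proof -
    have "V x \<in> \<U>" using VG[OF that(1)] by blast
    then show ?thesis using is_uniformity_onD(2)[OF u] that(2) by blast
  qed
    have cover: "(\<forall>U\<in>G ` ?S. openin X U) \<and> ?S \<subseteq> \<Union>(G ` ?S)"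
      using VG by blast
    have "\<exists>\<F>. finite \<F> \<and> \<F> \<subseteq> G ` ?S \<and> ?S \<subseteq> \<Union>\<F>"
      by (rule c[unfolded compact_space_alt, THEN spec, THEN mp, OF cover])
  then obtain F where F: "finite F" "F \<subseteq> ?S" "?S \<subseteq> (\<Union>x\<in>F. G x)"
    by (metis finite_subset_image)
  obtain U0 where U0: "U0 \<in> \<U>" using is_uniformity_onD(1)[OF u] by blast
  have "\<Inter>(insert U0 (V ` F)) \<in> \<U>"
    using F VG U0 by (intro Int_in) auto
  moreover have "\<Inter>(insert U0 (V ` F)) \<subseteq> W"
  proof
    fix p assume p: "p \<in> \<Inter>(insert U0 (V ` F))"
    obtain y z where yz: "p = (y, z)" by (cases p)
    have "p \<in> ?S \<times> ?S" using p is_uniformity_onD(3)[OF u U0] by blast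
    then have "y \<in> ?S" using yz by blast
    then obtain x where x: "x \<in> F" "y \<in> G x" using F by blast
    have xS: "x \<in> ?S" using x F by blast
    have "(y, z) \<in> V x" using p yz x by blast
    moreover have "(x, y) \<in> V x" using VG[OF xS] x by blast
    moreover have "(y, y) \<in> V x" using refl xS \<open>y \<in> ?S\<close> by blast
    ultimately have "(y, z) \<in> D" using VG[OF xS] by blast
    then show "p \<in> W" using D yz by blast
  qed
  ultimately show "W \<in> \<U>" using is_uniformity_onD(4)[OF u] W by blast
qed

lemma diagonal_neighbourhoods_uniformity:
  assumes c: "compact_space X" and h: "Hausdorff_space X"
  shows "is_uniformity_on (topspace X) (diagonal_neighbourhoods X)"
proof -
  let ?S = "topspace X" and ?N = "diagonal_neighbourhoods X"
  have reg: "regular_space X"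
    using c h compact_Hausdorff_imp_regular_space by blast
  have "?S \<times> ?S \<in> ?N"
    unfolding diagonal_neighbourhoods_def
    using openin_topspace[of "prod_topology X X"] by auto
  then have f1: "?N \<noteq> {}" by blast
  have f6: "U\<inverse> \<in> ?N" if U: "U \<in> ?N" for U
  proof -
    obtain D where D: "U \<subseteq> ?S \<times> ?S" "openin (prod_topology X X) D" "Id_on ?S \<subseteq> D" "D \<subseteq> U"
      using U unfolding diagonal_neighbourhoods_def by blast
    have "openin (prod_topology X X) (D\<inverse>)"
      unfolding openin_prod_topology_alt
    proof clarify
      fix x y assume "(y, x) \<in> D"
      then obtain A B where "openin X A" "openin X B" "y \<in> A" "x \<in> B" "A \<times> B \<subseteq> D"
        using D(2) unfolding openin_prod_topology_alt by meson
      then show "\<exists>A B. openin X A \<and> openin X B \<and> x \<in> A \<and> y \<in> B \<and> A \<times> B \<subseteq> D\<inverse>"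
        by (intro exI[of _ B] exI[of _ A]) auto
    qed
    then show ?thesis
      using D unfolding diagonal_neighbourhoods_def by blast
  qed
  have f7: "\<exists>V\<in>?N. V O V \<subseteq> U" if U: "U \<in> ?N" for U
  proof -
    obtain D where D: "U \<subseteq> ?S \<times> ?S" "openin (prod_topology X X) D" "Id_on ?S \<subseteq> D" "D \<subseteq> U"
      using U unfolding diagonal_neighbourhoods_def by blast
    have "\<exists>G H C. openin X G \<and> openin X H \<and> closedin X C \<and> x \<in> H \<and> H \<subseteq> C \<and> C \<subseteq> G \<and> G \<times> G \<subseteq> D"
      if x: "x \<in> ?S" for x
    proof -
      have "(x, x) \<in> D" using D x by blast
      then obtain A B where AB: "openin X A" "openin X B" "x \<in> A" "x \<in> B" "A \<times> B \<subseteq> D"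
        using D(2) unfolding openin_prod_topology_alt by meson
      have o: "openin X (A \<inter> B)" "x \<in> A \<inter> B" using AB by blast+
      then obtain H C where "openin X H" "closedin X C" "x \<in> H" "H \<subseteq> C" "C \<subseteq> A \<inter> B"
        using reg unfolding neighbourhood_base_of_closedin[symmetric] neighbourhood_base_of
        by meson
      moreover have "(A \<inter> B) \<times> (A \<inter> B) \<subseteq> D" using AB by blast
      ultimately show ?thesis using o by meson
    qed
    then obtain G H C where GHC: "\<And>x. x \<in> ?S \<Longrightarrow> openin X (G x) \<and> openin X (H x) \<and> closedin X (C x) \<and>
        x \<in> H x \<and> H x \<subseteq> C x \<and> C x \<subseteq> G x \<and> G x \<times> G x \<subseteq> D"
      by metis
    have cover: "(\<forall>U\<in>H ` ?S. openin X U) \<and> ?S \<subseteq> \<Union>(H ` ?S)"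
      using GHC by blast
    have "\<exists>\<F>. finite \<F> \<and> \<F> \<subseteq> H ` ?S \<and> ?S \<subseteq> \<Union>\<F>"
      by (rule c[unfolded compact_space_alt, THEN spec, THEN mp, OF cover])
    then obtain F where F: "finite F" "F \<subseteq> ?S" "?S \<subseteq> (\<Union>x\<in>F. H x)"
      by (metis finite_subset_image)
    let ?E = "\<lambda>x. G x \<times> G x \<union> (?S - C x) \<times> (?S - C x)"
    define V where "V = \<Inter>(insert (?S \<times> ?S) (?E ` F))"
    have E: "openin (prod_topology X X) (?E x)" if "x \<in> F" for x
    proof -
      have "x \<in> ?S" using F that by blast
      then show ?thesis
        using GHC[of x] by (intro openin_Un) (auto simp: openin_prod_Times_iff intro!: openin_diff)
    qed
    have "openin (prod_topology X X) V"
      unfolding V_def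
    proof (rule openin_Inter)
      show "openin (prod_topology X X) T" if "T \<in> insert (?S \<times> ?S) (?E ` F)" for T
        using that E openin_topspace[of "prod_topology X X"] by auto
    qed (use F in auto)
    moreover have "Id_on ?S \<subseteq> V"
    proof
      fix p assume "p \<in> Id_on ?S"
      then obtain y where y: "y \<in> ?S" "p = (y, y)" by (rule Id_onE)
      have "p \<in> ?E x" if "x \<in> F" for x
      proof -
        have "C x \<subseteq> G x" using GHC[of x] F(2) that by blast
        then show ?thesis using y by blast
      qed
      then show "p \<in> V" unfolding V_def using y by blast
    qed
    moreover have "V \<subseteq> ?S \<times> ?S" unfolding V_def by blast
    ultimately have "V \<in> ?N" unfolding diagonal_neighbourhoods_def by blast
    moreover have "V O V \<subseteq> U"
    proof clarify
      fix a b c assume ab: "(a, b) \<in> V" and bc: "(b, c) \<in> V"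
      have "b \<in> ?S" using ab unfolding V_def by blast
      then obtain x where x: "x \<in> F" "b \<in> H x" using F by blast
      have xS: "x \<in> ?S" using x F by blast
      have "b \<in> C x" using GHC[OF xS] x by blast
      moreover have "(a, b) \<in> ?E x" "(b, c) \<in> ?E x" using ab bc x unfolding V_def by blast+
      ultimately have "(a, c) \<in> G x \<times> G x" by blast
      then show "(a, c) \<in> U" using GHC[OF xS] D by blast
    qed
    ultimately show ?thesis by blast
  qed
  have f5: "U \<inter> V \<in> ?N" if "U \<in> ?N" "V \<in> ?N" for U V
  proof -
    obtain D where D: "U \<subseteq> ?S \<times> ?S" "openin (prod_topology X X) D" "Id_on ?S \<subseteq> D" "D \<subseteq> U"
      using \<open>U \<in> ?N\<close> unfolding diagonal_neighbourhoods_def by blast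
    obtain E where E: "openin (prod_topology X X) E" "Id_on ?S \<subseteq> E" "E \<subseteq> V"
      using \<open>V \<in> ?N\<close> unfolding diagonal_neighbourhoods_def by blast
    have "openin (prod_topology X X) (D \<inter> E)" using D(2) E(1) by (rule openin_Int)
    moreover have "Id_on ?S \<subseteq> D \<inter> E" "D \<inter> E \<subseteq> U \<inter> V" "U \<inter> V \<subseteq> ?S \<times> ?S"
      using D E by blast+
    ultimately show ?thesis unfolding diagonal_neighbourhoods_def by blast
  qed
  have f2: "Id_on ?S \<subseteq> U" if "U \<in> ?N" for U
    using that unfolding diagonal_neighbourhoods_def by blast
  have f3: "U \<subseteq> ?S \<times> ?S" if "U \<in> ?N" for U
    using that unfolding diagonal_neighbourhoods_def by blast
  have f4: "V \<in> ?N" if "U \<in> ?N" "U \<subseteq> V" "V \<subseteq> ?S \<times> ?S" for U V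
    using that unfolding diagonal_neighbourhoods_def by blast
  show ?thesis using f1 f2 f3 f4 f5 f6 f7 by (rule is_uniformity_onI)
qed

lemma diagonal_neighbourhoods_compatible:
  assumes c: "compact_space X" and h: "Hausdorff_space X"
  shows "uniform_topology (topspace X) (diagonal_neighbourhoods X) = X"
proof (rule topology_eq[THEN iffD2], intro allI iffI)
  let ?S = "topspace X" and ?N = "diagonal_neighbourhoods X"
  note o = openin_uniform_topology[OF diagonal_neighbourhoods_uniformity[OF c h]]
  fix G assume G: "openin (uniform_topology ?S ?N) G"
  have "\<exists>B. openin X B \<and> x \<in> B \<and> B \<subseteq> G" if x: "x \<in> G" for x
  proof -
    obtain U where U: "U \<in> ?N" "U `` {x} \<subseteq> G" using G x unfolding o by blast
    then obtain D where D: "openin (prod_topology X X) D" "Id_on ?S \<subseteq> D" "D \<subseteq> U"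
      unfolding diagonal_neighbourhoods_def by blast
    have "(x, x) \<in> D" using D G x unfolding o by blast
    then obtain A B where "openin X A" "openin X B" "x \<in> A" "x \<in> B" "A \<times> B \<subseteq> D"
      using D(1) unfolding openin_prod_topology_alt by meson
    then show ?thesis using D U by blast
  qed
  then show "openin X G" using openin_subopen by blast
next
  let ?S = "topspace X" and ?N = "diagonal_neighbourhoods X"
  note o = openin_uniform_topology[OF diagonal_neighbourhoods_uniformity[OF c h]]
  fix G assume G: "openin X G"
  have GS: "G \<subseteq> ?S" using G openin_subset by blast
  have "\<exists>U\<in>?N. U `` {x} \<subseteq> G" if x: "x \<in> G" for x
  proof -
    let ?D = "(?S - {x}) \<times> ?S \<union> ?S \<times> G"
    have "closedin X {x}" using closedin_t1_singleton[OF Hausdorff_imp_t1_space[OF h]] x GS by blast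
    then have "openin (prod_topology X X) ?D"
      using G by (intro openin_Un) (auto simp: openin_prod_Times_iff intro!: openin_diff)
    moreover have "Id_on ?S \<subseteq> ?D" using x by auto
    ultimately have "?D \<in> ?N" using GS unfolding diagonal_neighbourhoods_def by blast
    moreover have "?D `` {x} \<subseteq> G" by blast
    ultimately show ?thesis by blast
  qed
  then show "openin (uniform_topology ?S ?N) G" unfolding o using GS by blast
qed

lemma compact_uniformity:
  assumes "compact_space X" and "Hausdorff_space X"
  shows "is_uniformity_on (topspace X) (compact_uniformity X)"
    and "uniform_topology (topspace X) (compact_uniformity X) = X"
    and "compact_uniformity X = diagonal_neighbourhoods X"
proof -
  show *: "compact_uniformity X = diagonal_neighbourhoods X"
    unfolding compact_uniformity_def
    using assms compatible_uniformity_eq diagonal_neighbourhoods_uniformity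
      diagonal_neighbourhoods_compatible by (intro the_equality) blast+
  show "is_uniformity_on (topspace X) (compact_uniformity X)"
    "uniform_topology (topspace X) (compact_uniformity X) = X"
    using assms diagonal_neighbourhoods_uniformity diagonal_neighbourhoods_compatible
    unfolding * by blast+
qed


section \<open>The countable uniform power\<close>

definition sequence_entourage :: "'a set \<Rightarrow> ('a \<times> 'a) set \<Rightarrow> ((nat \<Rightarrow> 'a) \<times> (nat \<Rightarrow> 'a)) set" where
  "sequence_entourage S U =
     {(f, g). f \<in> UNIV \<rightarrow> S \<and> g \<in> UNIV \<rightarrow> S \<and> (\<forall>n. (f n, g n) \<in> U)}"

definition countable_uniform_power :: "'a topology \<Rightarrow> (nat \<Rightarrow> 'a) topology" where
  "countable_uniform_power X =
     (let P = (UNIV \<rightarrow> topspace X) :: (nat \<Rightarrow> 'a) set in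
      uniform_topology P
        (uniformity_from_base P (sequence_entourage (topspace X) ` compact_uniformity X)))"

lemma uniformity_on_sequences:
  assumes u: "is_uniformity_on S \<U>"
  shows "is_uniformity_on (UNIV \<rightarrow> S) (uniformity_from_base (UNIV \<rightarrow> S) (sequence_entourage S ` \<U>))"
proof -
  let ?P = "(UNIV \<rightarrow> S) :: (nat \<Rightarrow> 'a) set"
  let ?N = "uniformity_from_base ?P (sequence_entourage S ` \<U>)"
  have memN: "W \<in> ?N \<longleftrightarrow> W \<subseteq> ?P \<times> ?P \<and> (\<exists>U\<in>\<U>. sequence_entourage S U \<subseteq> W)" for W
    unfolding uniformity_from_base_def mem_Collect_eq bex_simps(7) by (rule refl)
  have sub: "sequence_entourage S U \<subseteq> ?P \<times> ?P" for U
    unfolding sequence_entourage_def by blast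
  have memI: "W \<in> ?N" if "U \<in> \<U>" "sequence_entourage S U \<subseteq> W" "W \<subseteq> ?P \<times> ?P" for U W
    unfolding memN by (intro conjI bexI[of _ U] that)
  have f3: "W \<subseteq> ?P \<times> ?P" if "W \<in> ?N" for W
    using that unfolding memN by (rule conjunct1)
  have ent: "\<exists>U\<in>\<U>. sequence_entourage S U \<subseteq> W" if "W \<in> ?N" for W
    using that unfolding memN by (rule conjunct2)
  obtain U0 where U0: "U0 \<in> \<U>" using is_uniformity_onD(1)[OF u] by (rule exE)
  have f1: "?N \<noteq> {}" using memI[OF U0 subset_refl sub] by (metis empty_iff)
  have f2: "Id_on ?P \<subseteq> W" if W: "W \<in> ?N" for W
  proof -
    obtain U where U: "U \<in> \<U>" "sequence_entourage S U \<subseteq> W" using ent[OF W] by (rule bexE)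
    have "Id_on S \<subseteq> U" using is_uniformity_onD(2)[OF u U(1)] .
    have "Id_on ?P \<subseteq> sequence_entourage S U"
    proof
      fix p assume "p \<in> Id_on ?P"
      then obtain f where f: "f \<in> ?P" "p = (f, f)" by (rule Id_onE)
      have "(f n, f n) \<in> U" for n
        using \<open>Id_on S \<subseteq> U\<close> Id_onI[OF funcset_mem[OF f(1) UNIV_I]] by (rule subsetD)
      then show "p \<in> sequence_entourage S U"
        unfolding f(2) sequence_entourage_def using f(1) by simp
    qed
    then show ?thesis using U(2) by (rule subset_trans)
  qed
  have f5: "W \<inter> W' \<in> ?N" if W: "W \<in> ?N" "W' \<in> ?N" for W W'
  proof -
    obtain U where U: "U \<in> \<U>" "sequence_entourage S U \<subseteq> W" using ent[OF W(1)] by (rule bexE)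
    obtain U' where U': "U' \<in> \<U>" "sequence_entourage S U' \<subseteq> W'" using ent[OF W(2)] by (rule bexE)
    have "sequence_entourage S (U \<inter> U') \<subseteq> sequence_entourage S U \<inter> sequence_entourage S U'"
      by (simp add: sequence_entourage_def subset_iff)
    then have "sequence_entourage S (U \<inter> U') \<subseteq> W \<inter> W'"
      using Int_mono[OF U(2) U'(2)] by (rule subset_trans)
    then show ?thesis
      using f3[OF W(1)] by (intro memI[OF is_uniformity_onD(5)[OF u U(1) U'(1)]] le_infI1)
  qed
  have f6: "W\<inverse> \<in> ?N" if W: "W \<in> ?N" for W
  proof -
    obtain U where U: "U \<in> \<U>" "sequence_entourage S U \<subseteq> W" using ent[OF W] by (rule bexE)
    have "sequence_entourage S (U\<inverse>) \<subseteq> (sequence_entourage S U)\<inverse>"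
      by (simp add: sequence_entourage_def subset_iff)
    also have "\<dots> \<subseteq> W\<inverse>" using U(2) by (simp only: converse_mono)
    finally have "sequence_entourage S (U\<inverse>) \<subseteq> W\<inverse>" .
    moreover have "W\<inverse> \<subseteq> (?P \<times> ?P)\<inverse>" using f3[OF W] by (simp only: converse_mono)
    then have "W\<inverse> \<subseteq> ?P \<times> ?P" by (simp only: converse_Times)
    ultimately show ?thesis by (rule memI[OF is_uniformity_onD(6)[OF u U(1)]])
  qed
  have f7: "\<exists>V\<in>?N. V O V \<subseteq> W" if W: "W \<in> ?N" for W
  proof -
    obtain U where U: "U \<in> \<U>" "sequence_entourage S U \<subseteq> W" using ent[OF W] by (rule bexE)
    obtain V where V: "V \<in> \<U>" "V O V \<subseteq> U" by (rule is_uniformity_on_half[OF u U(1)])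
    have "sequence_entourage S V O sequence_entourage S V \<subseteq> sequence_entourage S U"
    proof
      fix p assume "p \<in> sequence_entourage S V O sequence_entourage S V"
      then obtain f g h where p: "p = (f, h)" and
        fg: "(f, g) \<in> sequence_entourage S V" and gh: "(g, h) \<in> sequence_entourage S V"
        by (rule relcompE)
      have "(f n, g n) \<in> V" "(g n, h n) \<in> V" for n
        using fg gh by (simp_all add: sequence_entourage_def)
      then have "(f n, h n) \<in> U" for n
        using V(2) by (meson relcompI subsetD)
      then show "p \<in> sequence_entourage S U"
        using fg gh by (simp add: p sequence_entourage_def)
    qed
    then have "sequence_entourage S V O sequence_entourage S V \<subseteq> W"
      using U(2) by (rule subset_trans)
    then show ?thesis using memI[OF V(1) subset_refl sub] by (rule bexI)
  qed
  have f4: "V \<in> ?N" if V: "W \<in> ?N" "W \<subseteq> V" "V \<subseteq> ?P \<times> ?P" for W V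
  proof -
    obtain U where U: "U \<in> \<U>" "sequence_entourage S U \<subseteq> W" using ent[OF V(1)] by (rule bexE)
    show ?thesis by (rule memI[OF U(1) subset_trans[OF U(2) V(2)] V(3)])
  qed
  show ?thesis using f1 f2 f3 f4 f5 f6 f7 by (rule is_uniformity_onI)
qed


section \<open>Topological properties\<close>

text \<open>The separation axioms T1 and Hausdorff are part of the next two notions, as in Engelking's
  General Topology.\<close>

definition discrete_family_in :: "'a topology \<Rightarrow> 'i set \<Rightarrow> ('i \<Rightarrow> 'a set) \<Rightarrow> bool" where
  "discrete_family_in X I A \<longleftrightarrow>
     (\<forall>i\<in>I. A i \<subseteq> topspace X) \<and>
     (\<forall>x\<in>topspace X. \<exists>G. openin X G \<and> x \<in> G \<and>
        (\<forall>i\<in>I. \<forall>j\<in>I. A i \<inter> G \<noteq> {} \<and> A j \<inter> G \<noteq> {} \<longrightarrow> i = j))"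

text \<open>A discrete family has no repetitions among its nonempty members, so indexing the closed
  family by itself is no restriction.\<close>

definition collectionwise_normal_space :: "'a topology \<Rightarrow> bool" where
  "collectionwise_normal_space X \<longleftrightarrow>
     t1_space X \<and>
     (\<forall>\<F>. (\<forall>F\<in>\<F>. closedin X F) \<and> discrete_family_in X \<F> (\<lambda>F. F) \<longrightarrow>
        (\<exists>V. (\<forall>F\<in>\<F>. openin X (V F) \<and> F \<subseteq> V F) \<and> discrete_family_in X \<F> V))"

definition countably_paracompact_space :: "'a topology \<Rightarrow> bool" where
  "countably_paracompact_space X \<longleftrightarrow>
     Hausdorff_space X \<and>
     (\<forall>\<U>. countable \<U> \<and> (\<forall>U\<in>\<U>. openin X U) \<and> \<Union>\<U> = topspace X \<longrightarrow>
        (\<exists>\<V>. (\<forall>V\<in>\<V>. openin X V) \<and> \<Union>\<V> = topspace X \<and>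
             (\<forall>V\<in>\<V>. \<exists>U\<in>\<U>. V \<subseteq> U) \<and> locally_finite_in X \<V>))"

definition Frechet_Urysohn_space :: "'a topology \<Rightarrow> bool" where
  "Frechet_Urysohn_space X \<longleftrightarrow>
     (\<forall>A x. A \<subseteq> topspace X \<and> x \<in> X closure_of A \<longrightarrow>
        (\<exists>s :: nat \<Rightarrow> 'a. range s \<subseteq> A \<and> limitin X s x sequentially))"

end

theory Submission
  imports Defs
begin

text \<open>Let \<open>X\<close> be a compact subspace of \<open>\<Sigma> I\<^sup>K\<close>. A sequence \<open>y\<close> of points of \<open>X\<close>
  has, for each \<open>\<alpha> \<in> K\<close>, the coordinate \<open>i \<mapsto> y i \<alpha>\<close>, a bounded sequence of reals. If
  bounded sequences carry the supremum metric, the topology of the countable uniform power is that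
  of uniform closeness in finitely many coordinates; and since a countable union of countable sets
  is countable, only countably many coordinates of \<open>y\<close> are nonzero. Thus the countable uniform
  power embeds in a \<open>\<Sigma>\<close>-product of metric spaces, and its image is closed because \<open>X\<close> is
  compact (\<open>countable_uniform_power_sigma_closed\<close>).

  It remains to show that (sequentially) closed subspaces of \<open>\<Sigma>\<close>-products of metric spaces have
  the three properties. Whenever points are chosen one after the other, one may in each step control
  a further finite part of the supports of the points chosen before. A sequence which is closer and
  closer to a point \<open>y\<close> on the controlled coordinates then converges, as all its members are
  equal to the base point on the coordinates that are never controlled (\<open>history_limit\<close>). This
  gives the Frechet-Urysohn property at once. For the other two, the space is cut by a tree of
  successive subdivisions into cells which are ever smaller on more and more coordinates
  (\<open>sigma_discrete_cover\<close>), where the coordinates are chosen according to witnesses of the fact that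
  the closure of a cell is still too large, for instance that it meets two members of a given
  discrete family of closed sets. Along a branch through a point the witnesses would converge, so a
  small cell is reached after finitely many steps: the space has a \<open>\<sigma>\<close>-locally finite open cover by
  cells with small closures (\<open>sigma_locally_finite_cover\<close>). From such covers collectionwise
  normality and countable paracompactness follow by shrinking arguments.\<close>

section \<open>Discrete families\<close>

lemma discrete_family_nbhd:
  assumes "discrete_family_in X I A" and "x \<in> topspace X"
  obtains G where "openin X G" "x \<in> G"
    "\<forall>i\<in>I. \<forall>j\<in>I. A i \<inter> G \<noteq> {} \<and> A j \<inter> G \<noteq> {} \<longrightarrow> i = j"
  using assms(1)[unfolded discrete_family_in_def, THEN conjunct2, THEN bspec, OF assms(2)] that
  by (elim exE conjE)

lemma discrete_imp_locally_finite_in: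
  assumes "discrete_family_in X I A"
  shows "locally_finite_in X (A ` I)"
  unfolding locally_finite_in_def
proof (intro conjI ballI)
  show "\<Union>(A ` I) \<subseteq> topspace X" using assms unfolding discrete_family_in_def by blast
  fix x assume "x \<in> topspace X"
  then obtain G where G: "openin X G" "x \<in> G"
    and G1: "\<forall>i\<in>I. \<forall>j\<in>I. A i \<inter> G \<noteq> {} \<and> A j \<inter> G \<noteq> {} \<longrightarrow> i = j"
    by (rule discrete_family_nbhd[OF assms])
  have eq: "U = U'" if U: "U \<in> {U \<in> A ` I. U \<inter> G \<noteq> {}}" "U' \<in> {U \<in> A ` I. U \<inter> G \<noteq> {}}" for U U'
  proof -
    obtain i j where "i \<in> I" "U = A i" "j \<in> I" "U' = A j" using U by auto
    with G1 U show ?thesis by auto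
  qed
  have "finite {U \<in> A ` I. U \<inter> G \<noteq> {}}"
  proof (cases "{U \<in> A ` I. U \<inter> G \<noteq> {}} = {}")
    case False
    then obtain D where "D \<in> {U \<in> A ` I. U \<inter> G \<noteq> {}}" by auto
    then have "{U \<in> A ` I. U \<inter> G \<noteq> {}} \<subseteq> {D}" using eq by (metis (no_types, lifting) singleton_iff subsetI)
    then show ?thesis by (rule finite_subset) simp
  qed (simp only: finite.emptyI)
  then show "\<exists>G. openin X G \<and> x \<in> G \<and> finite {U \<in> A ` I. U \<inter> G \<noteq> {}}" using G by blast
qed

section \<open>Closed subspaces of \<open>\<Sigma>\<close>-products of metric spaces\<close>

text \<open>A sequentially closed subspace, up to homeomorphism, of the \<open>\<Sigma>\<close>-product of metric spaces with
  index set \<^term>\<open>K\<close> and base point \<^term>\<open>b\<close>. The point \<^term>\<open>y\<close> has the coordinates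
  \<^term>\<open>g y \<alpha>\<close>; the space is kept abstract, instead of being a set of functions, so that a
  topology given in another way can be equipped with coordinates. All factors have the same
  carrier type.\<close>

locale sigma_closed_space =
  fixes T :: "'y topology" and K :: "'k set" and g :: "'y \<Rightarrow> 'k \<Rightarrow> 'm::metric_space"
    and b :: "'k \<Rightarrow> 'm"
  assumes openin_iff: "openin T G \<longleftrightarrow> G \<subseteq> topspace T \<and>
      (\<forall>y\<in>G. \<exists>F \<epsilon>. finite F \<and> F \<subseteq> K \<and> \<epsilon> > 0 \<and>
         (\<forall>y'\<in>topspace T. (\<forall>\<alpha>\<in>F. dist (g y \<alpha>) (g y' \<alpha>) < \<epsilon>) \<longrightarrow> y' \<in> G))"
    and inj: "\<lbrakk>y \<in> topspace T; y' \<in> topspace T; \<And>\<alpha>. \<alpha> \<in> K \<Longrightarrow> g y \<alpha> = g y' \<alpha>\<rbrakk> \<Longrightarrow> y = y'"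
    and countable_support: "y \<in> topspace T \<Longrightarrow> countable {\<alpha>\<in>K. g y \<alpha> \<noteq> b \<alpha>}"
    and seq_closed: "\<lbrakk>\<And>n::nat. p n \<in> topspace T; \<And>\<alpha>. \<alpha> \<in> K \<Longrightarrow> (\<lambda>n. g (p n) \<alpha>) \<longlonglongrightarrow> w \<alpha>\<rbrakk>
        \<Longrightarrow> \<exists>z\<in>topspace T. \<forall>\<alpha>\<in>K. g z \<alpha> = w \<alpha>"
begin

text \<open>The basic entourage belonging to a set of coordinates and a radius.\<close>

definition near :: "'k set \<Rightarrow> real \<Rightarrow> 'y \<Rightarrow> 'y \<Rightarrow> bool" where
  "near F \<epsilon> y y' \<longleftrightarrow> (\<forall>\<alpha>\<in>F. dist (g y \<alpha>) (g y' \<alpha>) < \<epsilon>)"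

lemma near_refl: "\<epsilon> > 0 \<Longrightarrow> near F \<epsilon> y y"
  by (simp add: near_def)

lemma near_sym: "near F \<epsilon> y y' \<Longrightarrow> near F \<epsilon> y' y"
  by (simp add: near_def dist_commute)

lemma near_trans: "near F \<delta> x y \<Longrightarrow> near F \<epsilon> y z \<Longrightarrow> near F (\<delta> + \<epsilon>) x z"
  unfolding near_def by (metis add_strict_mono dist_triangle le_less_trans)

lemma openin_ball:
  assumes "finite F" "F \<subseteq> K"
  shows "openin T {y'\<in>topspace T. near F \<epsilon> y y'}"
  unfolding openin_iff
proof (intro conjI ballI)
  fix z assume z: "z \<in> {y' \<in> topspace T. near F \<epsilon> y y'}"
  define \<delta> where "\<delta> = Min (insert 1 ((\<lambda>\<alpha>. \<epsilon> - dist (g y \<alpha>) (g z \<alpha>)) ` F))"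
  have "\<delta> > 0" using z assms(1) by (auto simp: \<delta>_def near_def)
  moreover have "near F \<epsilon> y y'" if "\<forall>\<alpha>\<in>F. dist (g z \<alpha>) (g y' \<alpha>) < \<delta>" for y'
    unfolding near_def
  proof
    fix \<alpha> assume a: "\<alpha> \<in> F"
    then have "\<delta> \<le> \<epsilon> - dist (g y \<alpha>) (g z \<alpha>)" unfolding \<delta>_def using assms(1) by (intro Min_le) auto
    with that a show "dist (g y \<alpha>) (g y' \<alpha>) < \<epsilon>"
      using dist_triangle[of "g y \<alpha>" "g y' \<alpha>" "g z \<alpha>"] by fastforce
  qed
  ultimately show "\<exists>F' \<delta>. finite F' \<and> F' \<subseteq> K \<and> \<delta> > 0 \<and> (\<forall>y'\<in>topspace T.
      (\<forall>\<alpha>\<in>F'. dist (g z \<alpha>) (g y' \<alpha>) < \<delta>) \<longrightarrow> y' \<in> {y' \<in> topspace T. near F \<epsilon> y y'})"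
    using assms by blast
qed auto

lemma Hausdorff: "Hausdorff_space T"
  unfolding Hausdorff_space_def
proof (intro allI impI)
  fix x y assume xy: "x \<in> topspace T \<and> y \<in> topspace T \<and> x \<noteq> y"
  then obtain \<alpha> where a: "\<alpha> \<in> K" "g x \<alpha> \<noteq> g y \<alpha>" using inj by blast
  define \<epsilon> where "\<epsilon> = dist (g x \<alpha>) (g y \<alpha>) / 2"
  have e: "\<epsilon> > 0" using a by (simp add: \<epsilon>_def)
  have "disjnt {z\<in>topspace T. near {\<alpha>} \<epsilon> x z} {z\<in>topspace T. near {\<alpha>} \<epsilon> y z}"
  proof -
    have False if "dist (g x \<alpha>) (g z \<alpha>) < \<epsilon>" "dist (g y \<alpha>) (g z \<alpha>) < \<epsilon>" for z
      using that dist_triangle2[of "g x \<alpha>" "g y \<alpha>" "g z \<alpha>"] unfolding \<epsilon>_def by linarith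
    then show ?thesis unfolding disjnt_def near_def by blast
  qed
  then show "\<exists>U V. openin T U \<and> openin T V \<and> x \<in> U \<and> y \<in> V \<and> disjnt U V"
    using openin_ball[of "{\<alpha>}" \<epsilon>] a xy near_refl[OF e] by (metis (no_types, lifting)
      empty_subsetI finite.emptyI finite.insertI insert_subset mem_Collect_eq)
qed

lemma limitinI:
  assumes "z \<in> topspace T" "\<And>n. p n \<in> topspace T"
    and "\<And>\<alpha>. \<alpha> \<in> K \<Longrightarrow> (\<lambda>n. g (p n) \<alpha>) \<longlonglongrightarrow> g z \<alpha>"
  shows "limitin T p z sequentially"
  unfolding limitin_def
proof (intro conjI allI impI)
  fix U assume "openin T U \<and> z \<in> U"
  then obtain F \<epsilon> where F: "finite F" "F \<subseteq> K" "\<epsilon> > 0"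
    and U: "\<And>y'. \<lbrakk>y' \<in> topspace T; \<forall>\<alpha>\<in>F. dist (g z \<alpha>) (g y' \<alpha>) < \<epsilon>\<rbrakk> \<Longrightarrow> y' \<in> U"
    unfolding openin_iff by metis
  have "\<forall>\<^sub>F n in sequentially. \<forall>\<alpha>\<in>F. dist (g (p n) \<alpha>) (g z \<alpha>) < \<epsilon>"
    using F assms(3) by (intro eventually_ball_finite) (auto dest: tendstoD)
  then show "\<forall>\<^sub>F n in sequentially. p n \<in> U"
    by eventually_elim (use U assms(2) in \<open>auto simp: dist_commute\<close>)
qed (fact assms)

text \<open>Finitely many coordinates define a pseudometric, and this is the classical proof (through a
  well-order of the points) that a pseudometric space has a \<open>\<sigma>\<close>-discrete open cover by small
  sets. Points of \<open>S k x\<close> lie deep in the ball around \<open>x\<close>, with margin \<open>3 * d k\<close>, and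
  outside the balls around all earlier centres; hence points of \<open>S k x\<close> and \<open>S k x'\<close> are at
  distance at least \<open>3 * d k\<close>, and the \<open>d k\<close>-neighbourhoods of these sets form a discrete family.\<close>

lemma sigma_discrete_cover:
  assumes F: "finite F" "F \<subseteq> K" and e: "\<epsilon> > 0"
  obtains N :: "nat \<Rightarrow> 'y \<Rightarrow> 'y set" where
    "\<And>k x. openin T (N k x)"
    "\<And>k x z. z \<in> N k x \<Longrightarrow> near F \<epsilon> x z"
    "\<And>y. y \<in> topspace T \<Longrightarrow> \<exists>k x. y \<in> N k x"
    "\<And>k. discrete_family_in T UNIV (N k)"
proof -
  obtain r :: "'y rel" where r: "well_order_on UNIV r" using well_order_on by blast
  define lt where "lt x x' \<longleftrightarrow> (x, x') \<in> r - Id" for x x'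
  have "{(x, y). lt x y} = r - Id" unfolding lt_def by auto
  then have wf: "wf {(x, y). lt x y}" using r unfolding well_order_on_def by simp
  have tot: "lt x x' \<or> lt x' x" if "x \<noteq> x'" for x x'
    using r that unfolding well_order_on_def linear_order_on_def total_on_def lt_def by auto
  define d where "d k = 1 / (real k + 1)" for k :: nat
  have d: "d k > 0" for k by (simp add: d_def)
  define S where "S k x = {y\<in>topspace T. (\<forall>\<alpha>\<in>F. dist (g x \<alpha>) (g y \<alpha>) + 3 * d k \<le> \<epsilon>) \<and>
      (\<forall>x'. lt x' x \<longrightarrow> \<not> near F \<epsilon> x' y)}" for k x
  define N where "N k x = (\<Union>y\<in>S k x. {z\<in>topspace T. near F (d k) y z})" for k x
  show ?thesis
  proof
    show "openin T (N k x)" for k x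
      unfolding N_def using F by (intro openin_Union) (auto intro!: openin_ball)
    show "near F \<epsilon> x z" if z: "z \<in> N k x" for k x z
    proof -
      obtain y where y: "y \<in> S k x" "near F (d k) y z" using z unfolding N_def by blast
      show ?thesis unfolding near_def
      proof
        fix \<alpha> assume "\<alpha> \<in> F"
        then have "dist (g x \<alpha>) (g y \<alpha>) + 3 * d k \<le> \<epsilon>" "dist (g y \<alpha>) (g z \<alpha>) < d k"
          using y unfolding S_def near_def by auto
        then show "dist (g x \<alpha>) (g z \<alpha>) < \<epsilon>"
          using dist_triangle[of "g x \<alpha>" "g z \<alpha>" "g y \<alpha>"] d[of k] by linarith
      qed
    qed
    show "\<exists>k x. y \<in> N k x" if y: "y \<in> topspace T" for y
    proof -
      have "near F \<epsilon> y y" using e by (rule near_refl)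
      then obtain x where x: "near F \<epsilon> x y" and least: "\<And>x'. lt x' x \<Longrightarrow> \<not> near F \<epsilon> x' y"
        using wf[unfolded wf_eq_minimal, rule_format, of y "{x. near F \<epsilon> x y}"] by auto
      define \<mu> where "\<mu> = Min (insert 1 ((\<lambda>\<alpha>. \<epsilon> - dist (g x \<alpha>) (g y \<alpha>)) ` F))"
      have "\<mu> > 0" using F x by (auto simp: \<mu>_def near_def)
      then obtain k where k: "inverse (of_nat (Suc k)) < \<mu> / 3"
        using reals_Archimedean[of "\<mu> / 3"] by auto
      have "dist (g x \<alpha>) (g y \<alpha>) + 3 * d k \<le> \<epsilon>" if "\<alpha> \<in> F" for \<alpha>
      proof -
        have "\<mu> \<le> \<epsilon> - dist (g x \<alpha>) (g y \<alpha>)"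
          unfolding \<mu>_def using F that by (intro Min_le) auto
        moreover have "d k < \<mu> / 3" using k by (simp add: d_def inverse_eq_divide add.commute)
        ultimately show ?thesis by linarith
      qed
      then have "y \<in> S k x" using y least unfolding S_def by blast
      then have "y \<in> N k x" unfolding N_def using near_refl[OF d] y by blast
      then show ?thesis by blast
    qed
    show "discrete_family_in T UNIV (N k)" for k
      unfolding discrete_family_in_def
    proof (intro conjI ballI)
      show "N k x \<subseteq> topspace T" for x unfolding N_def by blast
      fix u assume u: "u \<in> topspace T"
      let ?G = "{z\<in>topspace T. near F (d k / 2) u z}"
      have not_lt: "\<not> lt x x'" if z: "z \<in> N k x \<inter> ?G" "z' \<in> N k x' \<inter> ?G" for x x' z z'
      proof
        assume lt: "lt x x'"
        obtain y y' where y: "y \<in> S k x" "near F (d k) y z" and y': "y' \<in> S k x'" "near F (d k) y' z'"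
          using z unfolding N_def by blast
        have "near F (d k + (d k / 2 + (d k / 2 + d k))) y y'"
          using z by (intro near_trans[OF y(2)] near_trans[OF near_sym[of _ _ u z]]
            near_trans[of _ _ u z'] near_sym[OF y'(2)]) auto
        then have yy: "near F (3 * d k) y y'" by (simp add: algebra_simps)
        have "near F \<epsilon> x y'" unfolding near_def
        proof
          fix \<alpha> assume "\<alpha> \<in> F"
          then have "dist (g x \<alpha>) (g y \<alpha>) + 3 * d k \<le> \<epsilon>" "dist (g y \<alpha>) (g y' \<alpha>) < 3 * d k"
            using y yy unfolding S_def near_def by auto
          then show "dist (g x \<alpha>) (g y' \<alpha>) < \<epsilon>"
            using dist_triangle[of "g x \<alpha>" "g y' \<alpha>" "g y \<alpha>"] by linarith
        qed
        then show False using y' lt unfolding S_def by blast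
      qed
      have "\<forall>x\<in>UNIV. \<forall>x'\<in>UNIV. N k x \<inter> ?G \<noteq> {} \<and> N k x' \<inter> ?G \<noteq> {} \<longrightarrow> x = x'"
      proof (intro ballI impI, elim conjE, rule ccontr)
        fix x x' assume "N k x \<inter> ?G \<noteq> {}" "N k x' \<inter> ?G \<noteq> {}" "x \<noteq> x'"
        then obtain z z' where z: "z \<in> N k x \<inter> ?G" "z' \<in> N k x' \<inter> ?G" by auto
        show False using not_lt[OF z] not_lt[OF z(2,1)] tot[OF \<open>x \<noteq> x'\<close>] by blast
      qed
      moreover have "openin T ?G" using F by (rule openin_ball)
      moreover have "u \<in> ?G" using u near_refl d by simp
      ultimately show "\<exists>G. openin T G \<and> u \<in> G \<and>
          (\<forall>x\<in>UNIV. \<forall>x'\<in>UNIV. N k x \<inter> G \<noteq> {} \<and> N k x' \<inter> G \<noteq> {} \<longrightarrow> x = x')"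
        by blast
    qed
  qed
qed

text \<open>The finite set of coordinates to be controlled after the points in the list \<^term>\<open>h\<close> have been
  chosen: of the support of each of these points (enumerated once and for all by
  \<^const>\<open>to_nat_on\<close>) the first \<^term>\<open>length h\<close> members. As the history grows, the supports of all
  its points are exhausted. Points outside the space are ignored, since their supports may be
  uncountable.\<close>

definition coords :: "'y list \<Rightarrow> 'k set" where
  "coords h = {\<alpha>\<in>K. \<exists>p\<in>set h \<inter> topspace T. g p \<alpha> \<noteq> b \<alpha> \<and>
      to_nat_on {\<alpha>\<in>K. g p \<alpha> \<noteq> b \<alpha>} \<alpha> < length h}"

lemma coords_subset: "coords h \<subseteq> K"
  by (auto simp: coords_def)

lemma finite_coords: "finite (coords h)"
proof -
  have "finite {\<alpha>\<in>K. g p \<alpha> \<noteq> b \<alpha> \<and> to_nat_on {\<alpha>\<in>K. g p \<alpha> \<noteq> b \<alpha>} \<alpha> < length h}"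
    if "p \<in> topspace T" for p
    using finite_vimage_IntI[OF finite_lessThan[of "length h"]
      inj_on_to_nat_on[OF countable_support[OF that]]]
    by (rule rev_finite_subset) auto
  then have "finite (\<Union>p\<in>set h \<inter> topspace T.
      {\<alpha>\<in>K. g p \<alpha> \<noteq> b \<alpha> \<and> to_nat_on {\<alpha>\<in>K. g p \<alpha> \<noteq> b \<alpha>} \<alpha> < length h})"
    by blast
  then show ?thesis by (rule rev_finite_subset) (auto simp: coords_def)
qed

lemma coords_mono: "set h \<subseteq> set h' \<Longrightarrow> length h \<le> length h' \<Longrightarrow> coords h \<subseteq> coords h'"
  unfolding coords_def by force

text \<open>The convergence principle behind all three properties. If \<open>p n\<close> is close to \<open>y\<close> on the
  coordinates controlled by the history before it, and enters the history after it, then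
  \<open>p n\<close> converges on the controlled coordinates to \<open>y\<close>, while on the remaining ones every
  \<open>p n\<close> equals the base point. The limit does not depend on the sequence \<open>p\<close>.\<close>

lemma history_limit:
  fixes L :: "nat \<Rightarrow> 'y list"
  assumes y: "y \<in> topspace T"
    and L: "\<And>n. set (L n) \<subseteq> set (L (Suc n))" "\<And>n. length (L n) < length (L (Suc n))"
    and p: "\<And>n. p n \<in> topspace T" "\<And>n. p n \<in> set (L (Suc n))"
    and close: "\<And>n \<alpha>. \<alpha> \<in> coords (L n) \<Longrightarrow> dist (g (p n) \<alpha>) (g y \<alpha>) \<le> 2 / real (Suc n)"
  obtains z where "z \<in> topspace T" "limitin T p z sequentially"
    "\<And>\<alpha>. \<alpha> \<in> K \<Longrightarrow> g z \<alpha> = (if \<alpha> \<in> (\<Union>n. coords (L n)) then g y \<alpha> else b \<alpha>)"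
proof -
  define w where "w \<alpha> = (if \<alpha> \<in> (\<Union>n. coords (L n)) then g y \<alpha> else b \<alpha>)" for \<alpha>
  have len: "n \<le> length (L n)" for n
  proof (induction n)
    case (Suc n)
    then show ?case using L(2)[of n] by linarith
  qed simp
  have sets: "set (L m) \<subseteq> set (L n)" if "m \<le> n" for m n
    using lift_Suc_mono_le[of "\<lambda>n. set (L n)"] L(1) that by blast
  have mono: "coords (L m) \<subseteq> coords (L n)" if "m \<le> n" for m n
    using lift_Suc_mono_le[of "\<lambda>n. coords (L n)"] coords_mono[OF L(1) less_imp_le[OF L(2)]] that
    by blast
  have lim: "(\<lambda>n. g (p n) \<alpha>) \<longlonglongrightarrow> w \<alpha>" if a: "\<alpha> \<in> K" for \<alpha>
  proof (cases "\<alpha> \<in> (\<Union>n. coords (L n))")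
    case True
    then obtain m where m: "\<alpha> \<in> coords (L m)" by blast
    have lim0: "(\<lambda>n. 2 / real (Suc n)) \<longlonglongrightarrow> 0"
      using LIMSEQ_Suc[OF lim_const_over_n[of 2]] by simp
    have ev: "\<forall>\<^sub>F n in sequentially. norm (dist (g (p n) \<alpha>) (w \<alpha>)) \<le> 2 / real (Suc n)"
      using eventually_ge_at_top[of m]
    proof eventually_elim
      case (elim n)
      have "w \<alpha> = g y \<alpha>" using True by (simp only: w_def if_True)
      moreover have "\<alpha> \<in> coords (L n)" using mono[OF elim] m by blast
      ultimately show ?case using close[of \<alpha> n] by (simp only: real_norm_def abs_of_nonneg zero_le_dist)
    qed
    show ?thesis
      by (rule tendsto_dist_iff[THEN iffD2, OF Lim_null_comparison[OF ev lim0]])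
  next
    case False
    have "g (p n) \<alpha> = b \<alpha>" for n
    proof (rule ccontr)
      assume n: "g (p n) \<alpha> \<noteq> b \<alpha>"
      define m where "m = Suc (max n (to_nat_on {\<alpha>\<in>K. g (p n) \<alpha> \<noteq> b \<alpha>} \<alpha>))"
      have "p n \<in> set (L m)" by (rule subsetD[OF sets p(2)]) (simp add: m_def)
      moreover have "to_nat_on {\<alpha>\<in>K. g (p n) \<alpha> \<noteq> b \<alpha>} \<alpha> < length (L m)"
        using len[of m] by (simp add: m_def)
      ultimately have "\<alpha> \<in> coords (L m)"
        unfolding coords_def using a n p(1)[of n] by auto
      then show False using False by blast
    qed
    then show ?thesis using False by (simp add: w_def)
  qed
  then obtain z where z: "z \<in> topspace T" "\<forall>\<alpha>\<in>K. g z \<alpha> = w \<alpha>" using seq_closed[of p w] p(1) by blast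
  moreover have "limitin T p z sequentially"
    using z lim p(1) by (intro limitinI) auto
  ultimately show ?thesis using that[OF z(1)] unfolding w_def by blast
qed

text \<open>The history starts with the limit point \<open>x\<close>, so its support is exhausted as well and the limit
  provided by the convergence principle is \<open>x\<close>.\<close>

lemma Frechet_Urysohn: "Frechet_Urysohn_space T"
  unfolding Frechet_Urysohn_space_def
proof (intro allI impI, elim conjE)
  fix A x assume A: "A \<subseteq> topspace T" and x: "x \<in> T closure_of A"
  have xT: "x \<in> topspace T" using x by (simp add: in_closure_of)
  have ex: "\<exists>p\<in>A. near F \<epsilon> x p" if F: "finite F" "F \<subseteq> K" "\<epsilon> > 0" for F \<epsilon>
  proof -
    have "x \<in> {y\<in>topspace T. near F \<epsilon> x y}" using xT near_refl F by simp
    then have "\<exists>p. p \<in> A \<and> p \<in> {y\<in>topspace T. near F \<epsilon> x y}"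
      using x openin_ball[OF F(1,2), of \<epsilon> x] unfolding in_closure_of by metis
    then show ?thesis by blast
  qed
  define pick where "pick n h = (SOME p. p \<in> A \<and> near (coords h) (1 / real (Suc n)) x p)" for n h
  define L where "L = rec_nat [x] (\<lambda>n h. pick n h # h)"
  have L: "L 0 = [x]" "L (Suc n) = pick n (L n) # L n" for n by (simp_all add: L_def)
  define p where "p n = pick n (L n)" for n
  have p: "p n \<in> A \<and> near (coords (L n)) (1 / real (Suc n)) x (p n)" for n
    unfolding p_def pick_def
    by (rule someI_ex) (use ex[OF finite_coords coords_subset, of "1 / real (Suc n)"] in auto)
  have close: "dist (g (p n) \<alpha>) (g x \<alpha>) \<le> 2 / real (Suc n)" if "\<alpha> \<in> coords (L n)" for n \<alpha>
  proof -
    have "dist (g x \<alpha>) (g (p n) \<alpha>) < 1 / real (Suc n)" using p that by (simp add: near_def)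
    also have "\<dots> \<le> 2 / real (Suc n)" by (intro divide_right_mono) auto
    finally show ?thesis by (simp add: dist_commute)
  qed
  obtain z where z: "z \<in> topspace T" "limitin T p z sequentially"
    and gz: "\<And>\<alpha>. \<alpha> \<in> K \<Longrightarrow> g z \<alpha> = (if \<alpha> \<in> (\<Union>n. coords (L n)) then g x \<alpha> else b \<alpha>)"
    using history_limit[of x L p] xT p A close L by (auto simp: p_def)
  have xL: "x \<in> set (L n)" for n by (induction n) (auto simp: L)
  have len: "length (L n) = Suc n" for n by (induction n) (auto simp: L)
  have "g x \<alpha> = b \<alpha>" if a: "\<alpha> \<in> K" "\<alpha> \<notin> (\<Union>n. coords (L n))" for \<alpha>
  proof (rule ccontr)
    assume "g x \<alpha> \<noteq> b \<alpha>"
    then have "\<alpha> \<in> coords (L (to_nat_on {\<alpha>\<in>K. g x \<alpha> \<noteq> b \<alpha>} \<alpha>))"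
      using a xT xL len by (force simp: coords_def)
    then show False using a by blast
  qed
  then have "z = x" using inj[OF z(1) xT] gz by auto
  then show "\<exists>s::nat \<Rightarrow> 'y. range s \<subseteq> A \<and> limitin T s x sequentially" using z p by blast
qed

end

section \<open>Covers by a tree of subdivisions\<close>

text \<open>The nodes reached from the root \<^term>\<open>r\<close> along a finite label sequence, written with the
  last label first. A node has, for each label \<^term>\<open>k\<close>, a whole family
  \<^term>\<open>range (child c k)\<close> of children, so that the countably many label sequences index
  arbitrarily large levels.\<close>

primrec tree_level :: "('c \<Rightarrow> nat \<Rightarrow> 'x \<Rightarrow> 'c) \<Rightarrow> 'c \<Rightarrow> nat list \<Rightarrow> 'c set" where
  "tree_level child r [] = {r}"
| "tree_level child r (k # s) = (\<Union>c\<in>tree_level child r s. range (child c k))"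

context sigma_closed_space
begin

text \<open>A node is a pair of a history and a cell, and a child cuts its parent's cell with a member of a
  discrete family that depends on the parent's history. A point has a neighbourhood meeting the
  cell of at most one parent, hence a smaller one meeting the cell of at most one child.\<close>

lemma tree_level_discrete:
  assumes M: "\<And>h k. discrete_family_in T UNIV (M h k)"
    and child: "\<And>c k x. snd (child c k x) = snd c \<inter> M (fst c) k x"
    and root: "snd r \<subseteq> topspace T"
  shows "discrete_family_in T (tree_level child r s) snd"
proof (induction s)
  case Nil
  show ?case using root unfolding discrete_family_in_def by auto
next
  case (Cons k s)
  show ?case unfolding discrete_family_in_def
  proof (intro conjI ballI)
    fix c assume "c \<in> tree_level child r (k # s)"
    then obtain c' x where c': "c' \<in> tree_level child r s" "c = child c' k x" by auto
    then have "snd c' \<subseteq> topspace T" using Cons unfolding discrete_family_in_def by blast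
    then show "snd c \<subseteq> topspace T" using c' child by auto
  next
    fix y assume y: "y \<in> topspace T"
    obtain G where G: "openin T G" "y \<in> G" and G1: "\<And>c c'. \<lbrakk>c \<in> tree_level child r s;
        c' \<in> tree_level child r s; snd c \<inter> G \<noteq> {}; snd c' \<inter> G \<noteq> {}\<rbrakk> \<Longrightarrow> c = c'"
      using Cons y unfolding discrete_family_in_def by metis
    show "\<exists>G. openin T G \<and> y \<in> G \<and> (\<forall>c\<in>tree_level child r (k # s). \<forall>c'\<in>tree_level child r (k # s).
        snd c \<inter> G \<noteq> {} \<and> snd c' \<inter> G \<noteq> {} \<longrightarrow> c = c')"
    proof (cases "\<exists>c\<in>tree_level child r s. snd c \<inter> G \<noteq> {}")
      case False
      have "snd c \<inter> G = {}" if "c \<in> tree_level child r (k # s)" for c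
        using that False child by fastforce
      then show ?thesis using G by blast
    next
      case True
      then obtain d where d: "d \<in> tree_level child r s" "snd d \<inter> G \<noteq> {}" by blast
      obtain G' where G': "openin T G'" "y \<in> G'" and G1': "\<And>x x'. \<lbrakk>M (fst d) k x \<inter> G' \<noteq> {};
          M (fst d) k x' \<inter> G' \<noteq> {}\<rbrakk> \<Longrightarrow> x = x'"
        using M[of "fst d" k] y unfolding discrete_family_in_def by (metis UNIV_I)
      have *: "\<exists>x. c = child d k x \<and> M (fst d) k x \<inter> G' \<noteq> {}"
        if c: "c \<in> tree_level child r (k # s)" "snd c \<inter> (G \<inter> G') \<noteq> {}" for c
      proof -
        obtain c' x where c': "c' \<in> tree_level child r s" "c = child c' k x" using c by auto
        have "snd c = snd c' \<inter> M (fst c') k x" using c' child by simp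
        then have "snd c' \<inter> G \<noteq> {}" "M (fst c') k x \<inter> G' \<noteq> {}" using c by auto
        moreover from this have "c' = d" using G1 c' d by blast
        ultimately show ?thesis using c' by blast
      qed
      have "c = c'" if "c \<in> tree_level child r (k # s)" "snd c \<inter> (G \<inter> G') \<noteq> {}"
          "c' \<in> tree_level child r (k # s)" "snd c' \<inter> (G \<inter> G') \<noteq> {}" for c c'
        using *[OF that(1,2)] *[OF that(3,4)] G1' by blast
      moreover have "openin T (G \<inter> G')" using G G' by blast
      ultimately show ?thesis using G G' by blast
    qed
  qed
qed

text \<open>The relation \<^term>\<open>R n\<close> says which pairs of points no cell should contain in its closure at
  stage \<^term>\<open>n\<close>; the hypothesis is that every point has a neighbourhood which is free of such
  pairs from some stage on. The cells are those of a tree of successive subdivisions. A cell whose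
  closure still contains a forbidden pair appends such a pair to the history, and so determines
  which coordinates the next subdivision has to control. If all cells on a branch through a point
  \<open>y\<close> were bad, both components of the recorded pairs would, by the convergence principle, converge
  to the same point \<open>z\<close>, contradicting the hypothesis at \<open>z\<close>. So the good cells cover, and
  those with the same label sequence form a discrete family.\<close>

lemma sigma_locally_finite_cover:
  fixes R :: "nat \<Rightarrow> ('y \<times> 'y) set"
  assumes R: "\<forall>z\<in>topspace T.
      \<exists>G m. openin T G \<and> z \<in> G \<and> (\<forall>n\<ge>m. R n \<inter> G \<times> G = {})"
  shows "\<exists>\<V> :: nat \<Rightarrow> 'y set set.
    (\<forall>n. locally_finite_in T (\<V> n)) \<and> (\<forall>n. \<forall>C\<in>\<V> n. openin T C) \<and>
    (\<forall>n. \<forall>C\<in>\<V> n. \<exists>m. R m \<inter> (T closure_of C) \<times> (T closure_of C) = {}) \<and>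
    (\<forall>y\<in>topspace T. \<exists>n. \<exists>C\<in>\<V> n. y \<in> C)"
proof -
  define good where "good C \<longleftrightarrow> (\<exists>m. R m \<inter> (T closure_of C) \<times> (T closure_of C) = {})" for C
  have "\<forall>h. \<exists>M :: nat \<Rightarrow> 'y \<Rightarrow> 'y set. (\<forall>k x. openin T (M k x)) \<and>
      (\<forall>k x z. z \<in> M k x \<longrightarrow> near (coords h) (1 / real (Suc (length h))) x z) \<and>
      (\<forall>y. y \<in> topspace T \<longrightarrow> (\<exists>k x. y \<in> M k x)) \<and> (\<forall>k. discrete_family_in T UNIV (M k))"
  proof (rule allI)
    fix h :: "'y list"
    have e: "1 / real (Suc (length h)) > 0" by simp
    show "\<exists>M :: nat \<Rightarrow> 'y \<Rightarrow> 'y set. (\<forall>k x. openin T (M k x)) \<and>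
      (\<forall>k x z. z \<in> M k x \<longrightarrow> near (coords h) (1 / real (Suc (length h))) x z) \<and>
      (\<forall>y. y \<in> topspace T \<longrightarrow> (\<exists>k x. y \<in> M k x)) \<and> (\<forall>k. discrete_family_in T UNIV (M k))"
      by (rule sigma_discrete_cover[OF finite_coords coords_subset e, of h]) blast
  qed
  then obtain M :: "'y list \<Rightarrow> nat \<Rightarrow> 'y \<Rightarrow> 'y set" where
    M_all: "\<forall>h. (\<forall>k x. openin T (M h k x)) \<and>
      (\<forall>k x z. z \<in> M h k x \<longrightarrow> near (coords h) (1 / real (Suc (length h))) x z) \<and>
      (\<forall>y. y \<in> topspace T \<longrightarrow> (\<exists>k x. y \<in> M h k x)) \<and> (\<forall>k. discrete_family_in T UNIV (M h k))"
    unfolding choice_iff by blast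
  have M: "openin T (M h k x)" "z \<in> M h k x \<Longrightarrow> near (coords h) (1 / real (Suc (length h))) x z"
    "y \<in> topspace T \<Longrightarrow> \<exists>k x. y \<in> M h k x" "discrete_family_in T UNIV (M h k)" for h k x y z
    using M_all by auto
  define wit where "wit h C = (SOME pq. pq \<in> R (length h) \<inter> (T closure_of C) \<times> (T closure_of C))"
    for h :: "'y list" and C
  \<comment> \<open>If the new cell is good, \<open>wit\<close> is arbitrary; this does not matter, as only branches without
    good cells are followed.\<close>
  define child where "child c k x =
      (let C = snd c \<inter> M (fst c) k x; pq = wit (fst c) C in (fst pq # snd pq # fst c, C))"
    for c :: "'y list \<times> 'y set" and k x
  have child: "snd (child c k x) = snd c \<inter> M (fst c) k x"
    "fst (child c k x) = fst (wit (fst c) (snd (child c k x))) # snd (wit (fst c) (snd (child c k x))) # fst c"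
    for c k x by (simp_all add: child_def Let_def)
  define r :: "'y list \<times> 'y set" where "r = ([], topspace T)"
  have disc: "discrete_family_in T (tree_level child r s) snd" for s
    by (rule tree_level_discrete[OF M(4) child(1)]) (simp add: r_def)
  have op: "openin T (snd c)" if "c \<in> tree_level child r s" for c s
    using that by (induction s arbitrary: c) (auto simp: r_def child(1) intro!: openin_Int M(1))
  define \<V> where "\<V> s = {C \<in> snd ` tree_level child r s. good C}" for s
  have branch: "\<exists>s. \<exists>C\<in>\<V> s. y \<in> C" if y: "y \<in> topspace T" for y
  proof (rule ccontr)
    assume no: "\<not> (\<exists>s. \<exists>C\<in>\<V> s. y \<in> C)"
    then have bad: "\<not> good (snd c)" if "c \<in> tree_level child r s" "y \<in> snd c" for c s
      using that unfolding \<V>_def by blast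
    define P where "P n c \<longleftrightarrow> length (fst c) = 2 * n \<and> y \<in> snd c \<and> (\<exists>s. c \<in> tree_level child r s)"
      for n :: nat and c
    have "\<exists>c. P 0 c" by (rule exI[of _ r]) (use y in \<open>auto simp: P_def r_def intro: exI[of _ "[]"]\<close>)
    moreover have "\<exists>c'. P (Suc n) c' \<and> (\<exists>k x. c' = child c k x)" if c: "P n c" for c n
    proof -
      obtain k x where kx: "y \<in> M (fst c) k x" using M(3) y by blast
      obtain s where s: "c \<in> tree_level child r s" using c unfolding P_def by blast
      have "child c k x \<in> tree_level child r (k # s)" using s by auto
      then have "P (Suc n) (child c k x)" using c kx unfolding P_def by (auto simp: child simp del: tree_level.simps)
      then show ?thesis by blast
    qed
    ultimately obtain c where c: "\<And>n. P n (c n)" "\<And>n. \<exists>k x. c (Suc n) = child (c n) k x"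
      using dependent_nat_choice[of P "\<lambda>n c c'. \<exists>k x. c' = child c k x"] by metis
    define L where "L n = fst (c n)" for n
    define C where "C n = snd (c (Suc n))" for n
    have len: "length (L n) = 2 * n" for n using c(1)[of n] by (simp add: P_def L_def)
    have L: "L (Suc n) = fst (wit (L n) (C n)) # snd (wit (L n) (C n)) # L n" for n
      using c(2)[of n] child(2) unfolding L_def C_def by metis
    have wit: "wit (L n) (C n) \<in> R (2 * n) \<inter> (T closure_of C n) \<times> (T closure_of C n)" for n
    proof -
      have "\<not> good (C n)" using c(1)[of "Suc n"] bad unfolding P_def C_def by blast
      then show ?thesis unfolding wit_def len good_def by (intro some_in_eq[THEN iffD2]) blast
    qed
    \<comment> \<open>The cell lies in a ball of radius \<open>?d\<close>, so its closure has diameter at most \<open>2 * ?d\<close>.\<close>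
    have close: "dist (g p \<alpha>) (g y \<alpha>) \<le> 2 / real (Suc n)"
      if p: "p \<in> T closure_of C n" and a: "\<alpha> \<in> coords (L n)" for p n \<alpha>
    proof (rule field_le_epsilon)
      fix e :: real assume e: "e > 0"
      let ?d = "1 / real (Suc (length (L n)))"
      obtain k x where kx: "c (Suc n) = child (c n) k x" using c(2) by blast
      have C: "C n \<subseteq> M (L n) k x" unfolding C_def L_def kx child(1) by blast
      have "y \<in> C n" using c(1)[of "Suc n"] unfolding P_def C_def by blast
      have aK: "\<alpha> \<in> K" using a coords_subset by blast
      have pT: "p \<in> topspace T" using p by (simp add: in_closure_of)
      have "p \<in> {z\<in>topspace T. near {\<alpha>} e p z}" using pT near_refl[OF e] by simp
      moreover have "openin T {z\<in>topspace T. near {\<alpha>} e p z}" using aK by (intro openin_ball) auto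
      ultimately have "\<exists>q. q \<in> C n \<and> q \<in> {z\<in>topspace T. near {\<alpha>} e p z}"
        using p unfolding in_closure_of by metis
      then obtain q where q: "q \<in> C n" "near {\<alpha>} e p q" by blast
      have 1: "dist (g p \<alpha>) (g q \<alpha>) < e" using q by (simp add: near_def)
      have 2: "dist (g x \<alpha>) (g q \<alpha>) < ?d" "dist (g x \<alpha>) (g y \<alpha>) < ?d"
        using M(2)[of q "L n" k x] M(2)[of y "L n" k x] C q \<open>y \<in> C n\<close> a unfolding near_def by auto
      have 3: "2 * ?d \<le> 2 / real (Suc n)" by (simp add: len field_simps)
      have "dist (g p \<alpha>) (g y \<alpha>) \<le> dist (g p \<alpha>) (g q \<alpha>) + (dist (g x \<alpha>) (g q \<alpha>) + dist (g x \<alpha>) (g y \<alpha>))"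

        using dist_triangle[of "g p \<alpha>" "g y \<alpha>" "g q \<alpha>"]
          dist_triangle3[of "g q \<alpha>" "g y \<alpha>" "g x \<alpha>"] by linarith
      with 1 2 3 show "dist (g p \<alpha>) (g y \<alpha>) \<le> 2 / real (Suc n) + e" by linarith
    qed
    define p q where "p n = fst (wit (L n) (C n))" and "q n = snd (wit (L n) (C n))" for n
    have pq: "(p n, q n) \<in> R (2 * n)" "p n \<in> T closure_of C n" "q n \<in> T closure_of C n" for n
      using wit[of n] by (auto simp: p_def q_def mem_Times_iff)
    have pqT: "p n \<in> topspace T" "q n \<in> topspace T" for n
      using pq[of n] by (auto simp: in_closure_of)
    have L': "L (Suc n) = p n # q n # L n" for n using L by (simp add: p_def q_def)
    have Ls: "set (L n) \<subseteq> set (L (Suc n))" "length (L n) < length (L (Suc n))"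
        "p n \<in> set (L (Suc n))" "q n \<in> set (L (Suc n))" for n
      unfolding L' by auto
    obtain z where z: "z \<in> topspace T" "limitin T p z sequentially"
      "\<And>\<alpha>. \<alpha> \<in> K \<Longrightarrow> g z \<alpha> = (if \<alpha> \<in> (\<Union>n. coords (L n)) then g y \<alpha> else b \<alpha>)"
      using history_limit[OF y Ls(1,2) pqT(1) Ls(3) close[OF pq(2)]] by metis
    obtain z' where z': "z' \<in> topspace T" "limitin T q z' sequentially"
      "\<And>\<alpha>. \<alpha> \<in> K \<Longrightarrow> g z' \<alpha> = (if \<alpha> \<in> (\<Union>n. coords (L n)) then g y \<alpha> else b \<alpha>)"
      using history_limit[OF y Ls(1,2) pqT(2) Ls(4) close[OF pq(3)]] by metis
    have zz: "z' = z" using inj[OF z'(1) z(1)] z(3) z'(3) by simp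
    obtain G m where G: "openin T G" "z \<in> G" "\<And>n. n \<ge> m \<Longrightarrow> R n \<inter> G \<times> G = {}"
      using bspec[OF R z(1)] by blast
    have "\<forall>\<^sub>F n in sequentially. p n \<in> G" "\<forall>\<^sub>F n in sequentially. q n \<in> G"
      using z(2) z'(2) G(1,2) unfolding limitin_def zz by auto
    then have "\<forall>\<^sub>F n in sequentially. p n \<in> G \<and> q n \<in> G \<and> n \<ge> m"
      using eventually_ge_at_top[of m] by eventually_elim auto
    then obtain n where "p n \<in> G" "q n \<in> G" "n \<ge> m"
      using eventually_happens'[OF sequentially_bot] by blast
    then show False using G(3)[of "2 * n"] pq(1)[of n] by auto
  qed
  have lf: "locally_finite_in T (\<V> s)" for s
    by (rule locally_finite_in_subset[OF discrete_imp_locally_finite_in[OF disc[of s]]])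
      (auto simp: \<V>_def)
  have op\<V>: "openin T C" if "C \<in> \<V> s" for s C
    using that op unfolding \<V>_def by blast
  have sm: "\<exists>m. R m \<inter> (T closure_of C) \<times> (T closure_of C) = {}" if "C \<in> \<V> s" for s C
    using that unfolding \<V>_def good_def by blast
  have cov: "\<exists>n. \<exists>C\<in>\<V> (from_nat n). y \<in> C" if "y \<in> topspace T" for y
    using branch[OF that] by (metis from_nat_to_nat)
  show ?thesis
    by (intro exI[of _ "\<lambda>n. \<V> (from_nat n)"] conjI allI ballI lf op\<V> sm cov)
qed

end

section \<open>Collectionwise normality and countable paracompactness\<close>

context sigma_closed_space
begin

text \<open>Forbidding pairs of points from two different members of \<^term>\<open>\<H>\<close> gives a
  \<open>\<sigma>\<close>-locally finite open cover by sets whose closures meet at most one member. The disjoint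
  neighbourhoods are then obtained by the usual shrinking: from the cells of the \<open>n\<close>-th family that
  touch \<open>H\<close>, remove the closures of those cells of the families up to \<open>n\<close> that touch another
  member.\<close>

lemma disjoint_expansion:
  assumes clo: "\<And>H. H \<in> \<H> \<Longrightarrow> closedin T H" and disc: "discrete_family_in T \<H> (\<lambda>H. H)"
  obtains V where "\<And>H. H \<in> \<H> \<Longrightarrow> openin T (V H)" "\<And>H. H \<in> \<H> \<Longrightarrow> H \<subseteq> V H"
    "\<And>H H'. \<lbrakk>H \<in> \<H>; H' \<in> \<H>; H \<noteq> H'\<rbrakk> \<Longrightarrow> V H \<inter> V H' = {}"
proof -
  define R where "R n = {(p, q). \<exists>H\<in>\<H>. \<exists>H'\<in>\<H>. p \<in> H \<and> q \<in> H' \<and> H \<noteq> H'}" for n :: nat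
  have R: "\<forall>z\<in>topspace T. \<exists>G m. openin T G \<and> z \<in> G \<and> (\<forall>n\<ge>m. R n \<inter> G \<times> G = {})"
  proof
    fix z assume z: "z \<in> topspace T"
    obtain G where G: "openin T G" "z \<in> G"
      and G1: "\<forall>H\<in>\<H>. \<forall>H'\<in>\<H>. H \<inter> G \<noteq> {} \<and> H' \<inter> G \<noteq> {} \<longrightarrow> H = H'"
      using disc z by (rule discrete_family_nbhd)
    have "R n \<inter> G \<times> G = {}" for n unfolding R_def using G1 by blast
    then show "\<exists>G m. openin T G \<and> z \<in> G \<and> (\<forall>n\<ge>m. R n \<inter> G \<times> G = {})"
      using G by blast
  qed
  obtain \<V> :: "nat \<Rightarrow> 'y set set" where
    lf: "\<And>n. locally_finite_in T (\<V> n)" and op: "\<And>n C. C \<in> \<V> n \<Longrightarrow> openin T C"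
    and sm: "\<And>n C. C \<in> \<V> n \<Longrightarrow> \<exists>m. R m \<inter> (T closure_of C) \<times> (T closure_of C) = {}"
    and cov: "\<And>y. y \<in> topspace T \<Longrightarrow> \<exists>n. \<exists>C\<in>\<V> n. y \<in> C"
    using sigma_locally_finite_cover[of R, OF R] by blast
  have one: "H = H'" if "C \<in> \<V> n" "H \<in> \<H>" "H' \<in> \<H>" "T closure_of C \<inter> H \<noteq> {}" "T closure_of C \<inter> H' \<noteq> {}"
    for C n H H' using sm[OF that(1)] that(2-) unfolding R_def by blast
  define U where "U H n = \<Union>{C \<in> \<V> n. T closure_of C \<inter> H \<noteq> {}}" for H n
  define B where "B n H = \<Union>{C \<in> \<V> n. \<exists>H'\<in>\<H>. H' \<noteq> H \<and> T closure_of C \<inter> H' \<noteq> {}}" for n H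
  define V where "V H = (\<Union>n. U H n - (\<Union>m\<in>{..n}. T closure_of (B m H)))" for H
  have clB: "T closure_of (B n H) \<inter> H = {}" if H: "H \<in> \<H>" for n H
  proof -
    have "locally_finite_in T {C \<in> \<V> n. \<exists>H'\<in>\<H>. H' \<noteq> H \<and> T closure_of C \<inter> H' \<noteq> {}}"
      by (rule locally_finite_in_subset[OF lf[of n]]) blast
    then have "T closure_of (B n H) =
        \<Union>((\<lambda>C. T closure_of C) ` {C \<in> \<V> n. \<exists>H'\<in>\<H>. H' \<noteq> H \<and> T closure_of C \<inter> H' \<noteq> {}})"
      unfolding B_def by (rule closure_of_locally_finite_Union)
    then show ?thesis using one[OF _ H] by blast
  qed
  have opU: "openin T (U H n)" for H n unfolding U_def using op by (intro openin_Union) blast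
  have disj: False if H: "H \<in> \<H>" "H' \<in> \<H>" "H \<noteq> H'" and "n \<le> n'" "x \<in> U H n"
    "x \<notin> (\<Union>m\<in>{..n'}. T closure_of (B m H'))" for H H' n n' x
  proof -
    have "U H n \<subseteq> B n H'" unfolding U_def B_def using H by blast
    moreover have "B n H' \<subseteq> topspace T"
      unfolding B_def using op[THEN openin_subset] by blast
    ultimately have "x \<in> T closure_of (B n H')" using that(5) closure_of_subset by blast
    then show False using that(4,6) by blast
  qed
  show ?thesis
  proof
    show "openin T (V H)" for H
      unfolding V_def by (intro openin_Union) (auto intro!: openin_diff opU closedin_Union)
    show "H \<subseteq> V H" if H: "H \<in> \<H>" for H
    proof
      fix x assume x: "x \<in> H"
      then have "x \<in> topspace T" using clo[OF H] closedin_subset by blast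
      then obtain n C where C: "C \<in> \<V> n" "x \<in> C" using cov by blast
      have "x \<in> T closure_of C" using closure_of_subset[OF openin_subset[OF op[OF C(1)]]] C by blast
      then have "x \<in> U H n" unfolding U_def using C x by blast
      then show "x \<in> V H" unfolding V_def using clB[OF H] x by blast
    qed
    show "V H \<inter> V H' = {}" if H: "H \<in> \<H>" "H' \<in> \<H>" "H \<noteq> H'" for H H'
    proof -
      have False if x: "x \<in> V H" "x \<in> V H'" for x
      proof -
        obtain n where n: "x \<in> U H n" "x \<notin> (\<Union>m\<in>{..n}. T closure_of (B m H))"
          using x(1) unfolding V_def by blast
        obtain n' where n': "x \<in> U H' n'" "x \<notin> (\<Union>m\<in>{..n'}. T closure_of (B m H'))"
          using x(2) unfolding V_def by blast
        show False
          using disj[OF H _ n(1) n'(2)] disj[OF H(2,1) H(3)[symmetric] _ n'(1) n(2)] nat_le_linear by blast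
      qed
      then show ?thesis by blast
    qed
  qed
qed

lemma normal: "normal_space T"
  unfolding normal_space_def
proof (intro allI impI, elim conjE)
  fix A B assume AB: "closedin T A" "closedin T B" "disjnt A B"
  have "discrete_family_in T {A, B} (\<lambda>H. H)"
    unfolding discrete_family_in_def
  proof (intro conjI ballI)
    show "H \<subseteq> topspace T" if "H \<in> {A, B}" for H using that AB closedin_subset by blast
    fix x assume x: "x \<in> topspace T"
    have op: "openin T (topspace T - A)" "openin T (topspace T - B)" using AB by blast+
    have "x \<notin> A \<or> x \<notin> B" using AB(3) by (auto simp: disjnt_def)
    then show "\<exists>G. openin T G \<and> x \<in> G \<and>
        (\<forall>H\<in>{A, B}. \<forall>H'\<in>{A, B}. H \<inter> G \<noteq> {} \<and> H' \<inter> G \<noteq> {} \<longrightarrow> H = H')"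
    proof
      assume "x \<notin> A"
      then show ?thesis using x op(1) by (intro exI[of _ "topspace T - A"]) blast
    next
      assume "x \<notin> B"
      then show ?thesis using x op(2) by (intro exI[of _ "topspace T - B"]) blast
    qed
  qed
  then obtain V where V: "\<And>H. H \<in> {A, B} \<Longrightarrow> openin T (V H)" "\<And>H. H \<in> {A, B} \<Longrightarrow> H \<subseteq> V H"
    "\<And>H H'. \<lbrakk>H \<in> {A, B}; H' \<in> {A, B}; H \<noteq> H'\<rbrakk> \<Longrightarrow> V H \<inter> V H' = {}"
    using disjoint_expansion[of "{A, B}"] AB by blast
  show "\<exists>U V. openin T U \<and> openin T V \<and> A \<subseteq> U \<and> B \<subseteq> V \<and> disjnt U V"
  proof (cases "A = B")
    case True
    then have "A = {}" "B = {}" using AB(3) by (auto simp: disjnt_def)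
    then show ?thesis by (intro exI[of _ "{}"]) auto
  next
    case False
    then show ?thesis using V[of A] V[of B] V(3)[of A B] unfolding disjnt_def by blast
  qed
qed

text \<open>By normality the disjoint neighbourhoods can be cut down to a neighbourhood of the closed union
  that stays away from the complement of their own union; this makes them discrete.\<close>

lemma collectionwise_normal: "collectionwise_normal_space T"
  unfolding collectionwise_normal_space_def
proof (intro conjI allI impI; (elim conjE)?)
  show "t1_space T" using Hausdorff by (rule Hausdorff_imp_t1_space)
  fix \<H> assume clo: "\<forall>H\<in>\<H>. closedin T H" and disc: "discrete_family_in T \<H> (\<lambda>H. H)"
  obtain V where V: "\<And>H. H \<in> \<H> \<Longrightarrow> openin T (V H)" "\<And>H. H \<in> \<H> \<Longrightarrow> H \<subseteq> V H"
    "\<And>H H'. \<lbrakk>H \<in> \<H>; H' \<in> \<H>; H \<noteq> H'\<rbrakk> \<Longrightarrow> V H \<inter> V H' = {}"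
    using disjoint_expansion[of \<H>] clo disc by blast
  have "locally_finite_in T \<H>" using discrete_imp_locally_finite_in[OF disc] by simp
  then have "closedin T (\<Union>\<H>)" using clo by (intro closedin_locally_finite_Union) auto
  moreover have "closedin T (topspace T - (\<Union>H\<in>\<H>. V H))" using V(1) by (intro closedin_diff) auto
  moreover have "disjnt (\<Union>\<H>) (topspace T - (\<Union>H\<in>\<H>. V H))" using V(2) unfolding disjnt_def by blast
  ultimately obtain W W' where W: "openin T W" "openin T W'" "\<Union>\<H> \<subseteq> W"
    "topspace T - (\<Union>H\<in>\<H>. V H) \<subseteq> W'" "disjnt W W'"
    using normal unfolding normal_space_def by meson
  have "discrete_family_in T \<H> (\<lambda>H. V H \<inter> W)"
    unfolding discrete_family_in_def
  proof (intro conjI ballI)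
    show "V H \<inter> W \<subseteq> topspace T" for H using openin_subset[OF W(1)] by blast
    fix x assume x: "x \<in> topspace T"
    show "\<exists>G. openin T G \<and> x \<in> G \<and>
        (\<forall>H\<in>\<H>. \<forall>H'\<in>\<H>. V H \<inter> W \<inter> G \<noteq> {} \<and> V H' \<inter> W \<inter> G \<noteq> {} \<longrightarrow> H = H')"
    proof (cases "x \<in> (\<Union>H\<in>\<H>. V H)")
      case True
      then obtain H where H: "H \<in> \<H>" "x \<in> V H" by blast
      have "H' = H" if "H' \<in> \<H>" "V H' \<inter> W \<inter> V H \<noteq> {}" for H' using V(3)[OF that(1) H(1)] that by blast
      then have "\<forall>H1\<in>\<H>. \<forall>H2\<in>\<H>. V H1 \<inter> W \<inter> V H \<noteq> {} \<and> V H2 \<inter> W \<inter> V H \<noteq> {} \<longrightarrow> H1 = H2"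
        by metis
      then show ?thesis using V(1)[OF H(1)] H(2) by (intro exI[of _ "V H"] conjI)
    next
      case False
      then have "x \<in> W'" using x W(4) by blast
      moreover have "V H \<inter> W \<inter> W' = {}" for H using W(5) unfolding disjnt_def by blast
      ultimately show ?thesis using W(2) by (intro exI[of _ W']) simp
    qed
  qed
  moreover have "\<forall>H\<in>\<H>. openin T (V H \<inter> W) \<and> H \<subseteq> V H \<inter> W"
    using V W by blast
  ultimately show "\<exists>V. (\<forall>H\<in>\<H>. openin T (V H) \<and> H \<subseteq> V H) \<and> discrete_family_in T \<H> V"
    by (intro exI[of _ "\<lambda>H. V H \<inter> W"] conjI)
qed

text \<open>Here the forbidden pairs at stage \<open>n\<close> are the diagonal pairs of points not yet covered by the
  first members of the cover, so the closure of each cell lies in finitely many \<open>u j\<close>. The set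
  \<open>D k\<close> is the closure of the union of those cells of the families up to \<open>k\<close> whose closures are
  covered by \<open>u 0, \<dots>, u k\<close>; removing \<open>D j\<close> from all later \<open>u k\<close> gives a locally finite
  refinement.\<close>

lemma countably_paracompact: "countably_paracompact_space T"
  unfolding countably_paracompact_space_def
proof (intro conjI allI impI; (elim conjE)?)
  show "Hausdorff_space T" by (rule Hausdorff)
  fix \<U> :: "'y set set"
  assume \<U>: "countable \<U>" "\<forall>U\<in>\<U>. openin T U" "\<Union>\<U> = topspace T"
  show "\<exists>\<W>. (\<forall>W\<in>\<W>. openin T W) \<and> \<Union>\<W> = topspace T \<and> (\<forall>W\<in>\<W>. \<exists>U\<in>\<U>. W \<subseteq> U) \<and> locally_finite_in T \<W>"
  proof (cases "\<U> = {}")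
    case True
    then show ?thesis using \<U> by (intro exI[of _ "{}"]) (auto simp: locally_finite_in_def)
  next
    case False
    define u where "u = from_nat_into \<U>"
    have u: "range u = \<U>" unfolding u_def using False \<U>(1) by (rule range_from_nat_into)
    have opu: "openin T (u n)" for n using u \<U>(2) by blast
    have covu: "\<exists>n. x \<in> u n" if "x \<in> topspace T" for x using that \<U>(3) u by blast
    define R where "R n = {(p, q). p = q \<and> p \<in> topspace T \<and> p \<notin> (\<Union>k\<in>{..n}. u k)}" for n :: nat
    have R: "\<forall>z\<in>topspace T. \<exists>G m. openin T G \<and> z \<in> G \<and> (\<forall>n\<ge>m. R n \<inter> G \<times> G = {})"
    proof
      fix z assume z: "z \<in> topspace T"
      obtain m where m: "z \<in> u m" using covu[OF z] by blast
      have "R n \<inter> u m \<times> u m = {}" if "n \<ge> m" for n unfolding R_def using that by auto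
      then show "\<exists>G m. openin T G \<and> z \<in> G \<and> (\<forall>n\<ge>m. R n \<inter> G \<times> G = {})"
        using m opu by blast
    qed
    obtain \<V> :: "nat \<Rightarrow> 'y set set" where
      lf: "\<And>n. locally_finite_in T (\<V> n)" and op: "\<And>n C. C \<in> \<V> n \<Longrightarrow> openin T C"
      and sm: "\<And>n C. C \<in> \<V> n \<Longrightarrow> \<exists>m. R m \<inter> (T closure_of C) \<times> (T closure_of C) = {}"
      and cov: "\<And>y. y \<in> topspace T \<Longrightarrow> \<exists>n. \<exists>C\<in>\<V> n. y \<in> C"
      using sigma_locally_finite_cover[of R, OF R] by blast
    define S where "S k n = {C \<in> \<V> n. T closure_of C \<subseteq> (\<Union>j\<in>{..k}. u j)}" for k n
    define D where "D k = (\<Union>n\<in>{..k}. T closure_of \<Union>(S k n))" for k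
    have "T closure_of \<Union>(S k n) \<subseteq> (\<Union>j\<in>{..k}. u j)" for k n
    proof -
      have "locally_finite_in T (S k n)" unfolding S_def by (rule locally_finite_in_subset[OF lf[of n]]) blast
      then show ?thesis by (simp only: closure_of_locally_finite_Union) (auto simp: S_def)
    qed
    then have D: "D k \<subseteq> (\<Union>j\<in>{..k}. u j)" for k unfolding D_def by blast
    have cloD: "closedin T (D k)" for k unfolding D_def by (intro closedin_Union) auto
    define W where "W k = u k - (\<Union>j\<in>{..<k}. D j)" for k
    have opW: "openin T (W k)" for k
      unfolding W_def by (intro openin_diff opu closedin_Union) (auto intro: cloD)
    have "\<exists>k. x \<in> W k" if x: "x \<in> topspace T" for x
    proof -
      define k where "k = (LEAST k. x \<in> u k)"
      have "x \<in> u k" unfolding k_def using covu[OF x] by (rule LeastI_ex)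
      moreover have "x \<notin> u j" if "j < k" for j using that not_less_Least unfolding k_def by blast
      then have "x \<notin> D j" if "j < k" for j using that D[of j] by fastforce
      ultimately show ?thesis unfolding W_def by blast
    qed
    then have covW: "\<Union>(range W) = topspace T" using opW[THEN openin_subset] by blast
    have "locally_finite_in T (range W)"
      unfolding locally_finite_in_def
    proof (intro conjI ballI)
      show "\<Union>(range W) \<subseteq> topspace T" using covW by blast
      fix x assume "x \<in> topspace T"
      then obtain n C where C: "C \<in> \<V> n" "x \<in> C" using cov by blast
      obtain m where m: "R m \<inter> (T closure_of C) \<times> (T closure_of C) = {}" using sm[OF C(1)] by blast
      define k where "k = max n m"
      have "T closure_of C \<subseteq> (\<Union>j\<in>{..m}. u j)"
        using m closure_of_subset_topspace[of T C] unfolding R_def by blast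
      also have "\<dots> \<subseteq> (\<Union>j\<in>{..k}. u j)" unfolding k_def by (intro UN_mono) auto
      finally have "C \<in> S k n" using C unfolding S_def by blast
      moreover have "\<Union>(S k n) \<subseteq> topspace T" unfolding S_def using op openin_subset by blast
      ultimately have "C \<subseteq> T closure_of \<Union>(S k n)" using closure_of_subset by blast
      moreover have "n \<in> {..k}" by (simp add: k_def)
      ultimately have CD: "C \<subseteq> D k" unfolding D_def by blast
      have "j \<le> k" if "W j \<inter> C \<noteq> {}" for j
      proof (rule ccontr)
        assume "\<not> j \<le> k"
        then have "D k \<inter> W j = {}" unfolding W_def by auto
        then show False using that CD by blast
      qed
      then have "{V \<in> range W. V \<inter> C \<noteq> {}} \<subseteq> W ` {..k}" by auto
      then have "finite {V \<in> range W. V \<inter> C \<noteq> {}}" by (rule finite_subset) simp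
      then show "\<exists>G. openin T G \<and> x \<in> G \<and> finite {V \<in> range W. V \<inter> G \<noteq> {}}" using C op by blast
    qed
    moreover have "\<exists>U\<in>\<U>. V \<subseteq> U" if "V \<in> range W" for V using that u unfolding W_def by blast
    ultimately show ?thesis using opW covW by (intro exI[of _ "range W"]) auto
  qed
qed

end

section \<open>The uniformity of a compact subspace of a cube\<close>

lemma embedding_into_cube:
  fixes f :: "'a \<Rightarrow> 'k \<Rightarrow> real"
  assumes emb: "embedding_map X (Sigma_product_interval K) f"
  shows "embedding_map X (product_topology (\<lambda>_. top_of_set {0..1}) K) f"
    and "x \<in> topspace X \<Longrightarrow> countable {\<alpha>\<in>K. f x \<alpha> \<noteq> 0}"
    and "x \<in> topspace X \<Longrightarrow> f x \<in> (\<Pi>\<^sub>E \<alpha>\<in>K. {0..1})"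
    and "inj_on f (topspace X)"
proof -
  have e: "embedding_map X (product_topology (\<lambda>_. top_of_set {0..1}) K) f"
    "f ` topspace X \<subseteq> {x. countable {\<alpha>\<in>K. x \<alpha> \<noteq> 0}}"
    using emb unfolding Sigma_product_interval_def embedding_map_in_subtopology by auto
  show "embedding_map X (product_topology (\<lambda>_. top_of_set {0..1}) K) f" by (rule e)
  show "countable {\<alpha>\<in>K. f x \<alpha> \<noteq> 0}" if "x \<in> topspace X" using e(2) that by blast
  have "continuous_map X (product_topology (\<lambda>_. top_of_set {0..1}) K) f"
    using homeomorphic_imp_continuous_map[OF e(1)[unfolded embedding_map_def]]
    by (simp add: continuous_map_in_subtopology)
  then have "f ` topspace X \<subseteq> topspace (product_topology (\<lambda>_. top_of_set {0..1::real}) K)"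
    by (rule continuous_map_image_subset_topspace)
  then show "f x \<in> (\<Pi>\<^sub>E \<alpha>\<in>K. {0..1})" if "x \<in> topspace X"
    using that by (auto simp: topspace_product_topology)
  show "inj_on f (topspace X)" using homeomorphic_imp_injective_map[OF e(1)[unfolded embedding_map_def]] .
qed

text \<open>The topology of an embedded subspace of a cube in terms of finitely many coordinates and a
  radius.\<close>

lemma openin_embedded_cube:
  fixes f :: "'a \<Rightarrow> 'k \<Rightarrow> real"
  assumes emb: "embedding_map X (product_topology (\<lambda>_. top_of_set {0..1}) K) f"
  shows "openin X G \<longleftrightarrow> G \<subseteq> topspace X \<and>
    (\<forall>x\<in>G. \<exists>F \<epsilon>. finite F \<and> F \<subseteq> K \<and> \<epsilon> > 0 \<and>
       (\<forall>c\<in>topspace X. (\<forall>\<alpha>\<in>F. \<bar>f x \<alpha> - f c \<alpha>\<bar> < \<epsilon>) \<longrightarrow> c \<in> G))" (is "_ \<longleftrightarrow> ?R")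
proof
  let ?P = "product_topology (\<lambda>_. top_of_set {0..1::real}) K"
  have hom: "homeomorphic_map X (subtopology ?P (f ` topspace X)) f"
    using emb unfolding embedding_map_def .
  have inj: "inj_on f (topspace X)" using hom by (rule homeomorphic_imp_injective_map)
  have cont: "continuous_map X ?P f" using homeomorphic_imp_continuous_map[OF hom] by (simp add: continuous_map_in_subtopology)
  have fP: "f x \<in> (\<Pi>\<^sub>E \<alpha>\<in>K. {0..1})" if "x \<in> topspace X" for x
    using continuous_map_image_subset_topspace[OF cont] that by (auto simp: topspace_product_topology)
  {
    assume G: "openin X G"
    then have GX: "G \<subseteq> topspace X" by (rule openin_subset)
    have "openin (subtopology ?P (f ` topspace X)) (f ` G)"
      using homeomorphic_map_openness_eq[OF hom] G by blast
    then obtain W where W: "openin ?P W" "f ` G = W \<inter> f ` topspace X"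
      unfolding openin_subtopology by blast
    show ?R
    proof (intro conjI ballI GX)
      fix x assume x: "x \<in> G"
      then have fxW: "f x \<in> W" using W by blast
      obtain U where U: "finite {i \<in> K. U i \<noteq> topspace (top_of_set {0..1::real})}"
          "\<forall>i\<in>K. openin (top_of_set {0..1::real}) (U i)" "f x \<in> PiE K U" "PiE K U \<subseteq> W"
        using W(1)[unfolded openin_product_topology_alt, rule_format, OF fxW] by blast
      define F where "F = {i \<in> K. U i \<noteq> topspace (top_of_set {0..1::real})}"
      have "\<exists>e>0. \<forall>y\<in>{0..1}. dist y (f x i) < e \<longrightarrow> y \<in> U i" if "i \<in> K" for i
        using U(2,3) that unfolding openin_euclidean_subtopology_iff by (auto simp: PiE_iff)
      then obtain e where e: "\<And>i. i \<in> K \<Longrightarrow> e i > 0"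
        "\<And>i y. \<lbrakk>i \<in> K; y \<in> {0..1}; dist y (f x i) < e i\<rbrakk> \<Longrightarrow> y \<in> U i" by metis
      define \<epsilon> where "\<epsilon> = Min (insert 1 (e ` F))"
      have F: "finite F" "F \<subseteq> K" using U(1) unfolding F_def by auto
      have "\<epsilon> > 0" using F e(1) by (auto simp: \<epsilon>_def)
      moreover have "c \<in> G" if c: "c \<in> topspace X" "\<forall>\<alpha>\<in>F. \<bar>f x \<alpha> - f c \<alpha>\<bar> < \<epsilon>" for c
      proof -
        have "f c i \<in> U i" if i: "i \<in> K" for i
        proof (cases "i \<in> F")
          case True
          then have "\<epsilon> \<le> e i" using F unfolding \<epsilon>_def by (intro Min_le) auto
          then have "dist (f c i) (f x i) < e i"
            using c(2) True by (force simp: dist_real_def abs_minus_commute)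
          then show ?thesis using e(2)[OF i] fP[OF c(1)] i by (auto simp: PiE_iff)
        next
          case False
          then have "U i = {0..1}" using i unfolding F_def by simp
          then show ?thesis using fP[OF c(1)] i by (auto simp: PiE_iff)
        qed
        then have "f c \<in> PiE K U" using fP[OF c(1)] by (auto simp: PiE_iff)
        then have "f c \<in> f ` G" using U(4) W(2) c(1) by blast
        then show ?thesis using inj c(1) GX by (auto dest: inj_onD)
      qed
      ultimately show "\<exists>F \<epsilon>. finite F \<and> F \<subseteq> K \<and> \<epsilon> > 0 \<and>
          (\<forall>c\<in>topspace X. (\<forall>\<alpha>\<in>F. \<bar>f x \<alpha> - f c \<alpha>\<bar> < \<epsilon>) \<longrightarrow> c \<in> G)" using F by blast
    qed
  }
  {
    assume R: ?R
    show "openin X G"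
    proof (subst openin_subopen, intro ballI)
      fix x assume x: "x \<in> G"
      then obtain F \<epsilon> where F: "finite F" "F \<subseteq> K" "\<epsilon> > 0"
        and FG: "\<forall>c\<in>topspace X. (\<forall>\<alpha>\<in>F. \<bar>f x \<alpha> - f c \<alpha>\<bar> < \<epsilon>) \<longrightarrow> c \<in> G" using R by blast
      have xX: "x \<in> topspace X" using R x by blast
      define B where "B \<alpha> = {c\<in>topspace X. f c \<alpha> \<in> ball (f x \<alpha>) \<epsilon>}" for \<alpha>
      have "openin X (B \<alpha>)" if "\<alpha> \<in> F" for \<alpha>
      proof -
        have "continuous_map X (top_of_set {0..1}) (\<lambda>c. f c \<alpha>)"
          using cont that F(2) unfolding continuous_map_componentwise by blast
        then have "continuous_map X euclideanreal (\<lambda>c. f c \<alpha>)"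
          by (simp add: continuous_map_in_subtopology)
        then show ?thesis unfolding B_def by (rule openin_continuous_map_preimage) simp
      qed
      then have "openin X (\<Inter>(insert (topspace X) (B ` F)))"
        using F(1) by (intro openin_Inter) auto
      moreover have "x \<in> \<Inter>(insert (topspace X) (B ` F))" using xX F(3) by (auto simp: B_def)
      moreover have "\<Inter>(insert (topspace X) (B ` F)) \<subseteq> G"
        using FG by (auto simp: B_def dist_real_def)
      ultimately show "\<exists>T. openin X T \<and> x \<in> T \<and> T \<subseteq> G" by blast
    qed
  }
qed

text \<open>The base of the uniformity induced by finitely many real-valued coordinates at a time.\<close>

definition coordinate_entourages :: "'a set \<Rightarrow> 'k set \<Rightarrow> ('a \<Rightarrow> 'k \<Rightarrow> real) \<Rightarrow> ('a \<times> 'a) set set" where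
  "coordinate_entourages S K f =
     {{(x, y). x \<in> S \<and> y \<in> S \<and> (\<forall>\<alpha>\<in>F. \<bar>f x \<alpha> - f y \<alpha>\<bar> < \<epsilon>)} | F \<epsilon>.
        finite F \<and> F \<subseteq> K \<and> \<epsilon> > 0}"

lemma uniformity_from_coordinates:
  "is_uniformity_on S (uniformity_from_base S (coordinate_entourages S K f))"
proof -
  let ?E = "\<lambda>F \<epsilon>. {(x, y). x \<in> S \<and> y \<in> S \<and> (\<forall>\<alpha>\<in>F. \<bar>f x \<alpha> - f y \<alpha>\<bar> < \<epsilon>)}"
  let ?U = "uniformity_from_base S (coordinate_entourages S K f)"
  have mem: "W \<in> ?U \<longleftrightarrow> W \<subseteq> S \<times> S \<and> (\<exists>F \<epsilon>. finite F \<and> F \<subseteq> K \<and> \<epsilon> > 0 \<and> ?E F \<epsilon> \<subseteq> W)" for W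
    unfolding uniformity_from_base_def coordinate_entourages_def by blast
  show ?thesis
  proof (rule is_uniformity_onI)
    have "S \<times> S \<in> ?U" unfolding mem by (intro conjI exI[of _ "{}"] exI[of _ 1]) auto
    then show "?U \<noteq> {}" by blast
    show "Id_on S \<subseteq> W" if W: "W \<in> ?U" for W
    proof -
      obtain F \<epsilon> where "\<epsilon> > 0" "?E F \<epsilon> \<subseteq> W" using W unfolding mem by blast
      then show ?thesis by (force simp: Id_on_def)
    qed
    show "W \<subseteq> S \<times> S" if "W \<in> ?U" for W using that unfolding mem by blast
    show "V \<in> ?U" if "W \<in> ?U" "W \<subseteq> V" "V \<subseteq> S \<times> S" for W V
      using that unfolding mem by (meson order_trans)
    show "W \<inter> V \<in> ?U" if WV: "W \<in> ?U" "V \<in> ?U" for W V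
    proof -
      obtain F \<epsilon> where F: "finite F" "F \<subseteq> K" "\<epsilon> > 0" "?E F \<epsilon> \<subseteq> W" using WV(1) unfolding mem by blast
      obtain F' \<epsilon>' where F': "finite F'" "F' \<subseteq> K" "\<epsilon>' > 0" "?E F' \<epsilon>' \<subseteq> V"
        using WV(2) unfolding mem by blast
      have "?E (F \<union> F') (min \<epsilon> \<epsilon>') \<subseteq> ?E F \<epsilon> \<inter> ?E F' \<epsilon>'" by auto
      then have "?E (F \<union> F') (min \<epsilon> \<epsilon>') \<subseteq> W \<inter> V" using F(4) F'(4) by blast
      moreover have "W \<inter> V \<subseteq> S \<times> S" using that unfolding mem by blast
      moreover have "finite (F \<union> F')" "F \<union> F' \<subseteq> K" "min \<epsilon> \<epsilon>' > 0" using F F' by auto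
      ultimately show ?thesis unfolding mem by blast
    qed
    show "W\<inverse> \<in> ?U" if W: "W \<in> ?U" for W
    proof -
      obtain F \<epsilon> where F: "finite F" "F \<subseteq> K" "\<epsilon> > 0" "?E F \<epsilon> \<subseteq> W" using W unfolding mem by blast
      have "?E F \<epsilon> \<subseteq> (?E F \<epsilon>)\<inverse>" by (auto simp: abs_minus_commute)
      then have "?E F \<epsilon> \<subseteq> W\<inverse>" using F(4) by blast
      moreover have "W\<inverse> \<subseteq> S \<times> S" using that unfolding mem by blast
      ultimately show ?thesis unfolding mem using F by blast
    qed
    show "\<exists>V\<in>?U. V O V \<subseteq> W" if W: "W \<in> ?U" for W
    proof -
      obtain F \<epsilon> where F: "finite F" "F \<subseteq> K" "\<epsilon> > 0" "?E F \<epsilon> \<subseteq> W" using W unfolding mem by blast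
      have "?E F (\<epsilon> / 2) O ?E F (\<epsilon> / 2) \<subseteq> ?E F \<epsilon>"
      proof clarsimp
        fix x y z \<alpha>
        assume "\<forall>\<alpha>\<in>F. \<bar>f x \<alpha> - f y \<alpha>\<bar> * 2 < \<epsilon>" "\<forall>\<alpha>\<in>F. \<bar>f y \<alpha> - f z \<alpha>\<bar> * 2 < \<epsilon>" "\<alpha> \<in> F"
        then have "\<bar>f x \<alpha> - f y \<alpha>\<bar> * 2 < \<epsilon>" "\<bar>f y \<alpha> - f z \<alpha>\<bar> * 2 < \<epsilon>" by blast+
        moreover have "\<bar>f x \<alpha> - f z \<alpha>\<bar> \<le> \<bar>f x \<alpha> - f y \<alpha>\<bar> + \<bar>f y \<alpha> - f z \<alpha>\<bar>"
          using abs_triangle_ineq[of "f x \<alpha> - f y \<alpha>" "f y \<alpha> - f z \<alpha>"] by simp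
        ultimately show "\<bar>f x \<alpha> - f z \<alpha>\<bar> < \<epsilon>" by simp
      qed
      then have "?E F (\<epsilon> / 2) O ?E F (\<epsilon> / 2) \<subseteq> W" using F(4) by blast
      moreover have "?E F (\<epsilon> / 2) \<in> ?U"
        unfolding mem using F by (intro conjI exI[of _ F] exI[of _ "\<epsilon> / 2"]) auto
      ultimately show ?thesis by blast
    qed
  qed
qed

text \<open>By uniqueness of the compatible uniformity of a compactum, it suffices that the uniformity of the
  coordinates induces the topology.\<close>

lemma compact_uniformity_from_coordinates:
  fixes f :: "'a \<Rightarrow> 'k \<Rightarrow> real"
  assumes "compact_space X" "Hausdorff_space X"
    and emb: "embedding_map X (product_topology (\<lambda>_. top_of_set {0..1}) K) f"
  shows "compact_uniformity X = uniformity_from_base (topspace X) (coordinate_entourages (topspace X) K f)"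
    (is "_ = ?U")
proof -
  let ?E = "\<lambda>F \<epsilon>. {(x, y). x \<in> topspace X \<and> y \<in> topspace X \<and> (\<forall>\<alpha>\<in>F. \<bar>f x \<alpha> - f y \<alpha>\<bar> < \<epsilon>)}"
  have u: "is_uniformity_on (topspace X) ?U" by (rule uniformity_from_coordinates)
  have "uniform_topology (topspace X) ?U = X"
  proof (rule topology_eq[THEN iffD2], rule allI)
    fix G
    have *: "(\<exists>U\<in>?U. U `` {x} \<subseteq> G) \<longleftrightarrow> (\<exists>F \<epsilon>. finite F \<and> F \<subseteq> K \<and> \<epsilon> > 0 \<and>
       (\<forall>c\<in>topspace X. (\<forall>\<alpha>\<in>F. \<bar>f x \<alpha> - f c \<alpha>\<bar> < \<epsilon>) \<longrightarrow> c \<in> G))" (is "?l \<longleftrightarrow> ?r")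
      if x: "x \<in> topspace X" for x
    proof
      assume ?l
      then obtain U F \<epsilon> where U: "U `` {x} \<subseteq> G" and F: "finite F" "F \<subseteq> K" "\<epsilon> > 0" "?E F \<epsilon> \<subseteq> U"
        unfolding uniformity_from_base_def coordinate_entourages_def by blast
      have "c \<in> G" if "c \<in> topspace X" "\<forall>\<alpha>\<in>F. \<bar>f x \<alpha> - f c \<alpha>\<bar> < \<epsilon>" for c
        using that x U F(4) by blast
      then show ?r using F by blast
    next
      assume ?r
      then obtain F \<epsilon> where F: "finite F" "F \<subseteq> K" "\<epsilon> > 0"
        and G: "\<forall>c\<in>topspace X. (\<forall>\<alpha>\<in>F. \<bar>f x \<alpha> - f c \<alpha>\<bar> < \<epsilon>) \<longrightarrow> c \<in> G" by blast
      have "?E F \<epsilon> \<in> coordinate_entourages (topspace X) K f"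
        unfolding coordinate_entourages_def using F by blast
      then have "?E F \<epsilon> \<in> ?U" unfolding uniformity_from_base_def by blast
      moreover have "?E F \<epsilon> `` {x} \<subseteq> G" using G by blast
      ultimately show ?l by blast
    qed
    show "openin (uniform_topology (topspace X) ?U) G \<longleftrightarrow> openin X G"
      unfolding openin_uniform_topology[OF u] openin_embedded_cube[OF emb]
      using * by (meson subsetD)
  qed
  then have "?U = diagonal_neighbourhoods X"
    using compatible_uniformity_eq[OF assms(1) u] by blast
  then show ?thesis using compact_uniformity(3)[OF assms(1,2)] by simp
qed

section \<open>The countable uniform power of a Corson compactum\<close>

text \<open>The \<open>\<alpha>\<close>-th coordinate of a sequence \<open>y\<close> of points is the bounded real sequence
  \<open>i \<mapsto> f (y i) \<alpha>\<close>, an element of the space of bounded sequences with the supremum metric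
  (bounded continuous functions on the discrete space of natural numbers). Uniform closeness of
  sequences of points is closeness of finitely many of these coordinates; the support of \<open>y\<close> is
  the union of the countably many supports of its terms; and the power is closed because
  the compact image of \<open>X\<close> is closed in the cube. Only coordinates in \<^term>\<open>K\<close> and sequences in
  the space matter; elsewhere \<^const>\<open>Bcontfun\<close> may be applied to unbounded functions.\<close>

lemma countable_uniform_power_sigma_closed:
  fixes f :: "'a \<Rightarrow> 'k \<Rightarrow> real"
  assumes cpt: "compact_space X" and hd: "Hausdorff_space X"
    and emb: "embedding_map X (Sigma_product_interval K) f"
  shows "sigma_closed_space (countable_uniform_power X) K
    (\<lambda>y \<alpha>. Bcontfun (\<lambda>i. f (y i) \<alpha>) :: nat \<Rightarrow>\<^sub>C real) (\<lambda>_. 0)"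
proof -
  let ?S = "topspace X" and ?T = "countable_uniform_power X"
  let ?g = "\<lambda>y \<alpha>. Bcontfun (\<lambda>i. f (y i) \<alpha>) :: nat \<Rightarrow>\<^sub>C real"
  let ?P = "product_topology (\<lambda>_. top_of_set {0..1::real}) K"
  let ?E = "\<lambda>F \<epsilon>. {(x, y). x \<in> ?S \<and> y \<in> ?S \<and> (\<forall>\<alpha>\<in>F. \<bar>f x \<alpha> - f y \<alpha>\<bar> < \<epsilon>)}"
  note cube = embedding_into_cube[OF emb]
  have hom: "homeomorphic_map X (subtopology ?P (f ` ?S)) f"
    using cube(1) unfolding embedding_map_def .
  have u: "is_uniformity_on (UNIV \<rightarrow> ?S)
      (uniformity_from_base (UNIV \<rightarrow> ?S) (sequence_entourage ?S ` compact_uniformity X))"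
    by (rule uniformity_on_sequences[OF compact_uniformity(1)[OF cpt hd]])
  have T: "?T = uniform_topology (UNIV \<rightarrow> ?S)
      (uniformity_from_base (UNIV \<rightarrow> ?S) (sequence_entourage ?S ` compact_uniformity X))"
    unfolding countable_uniform_power_def Let_def by (rule refl)
  have topT: "topspace ?T = (UNIV \<rightarrow> ?S)" unfolding T by (rule topspace_uniform_topology[OF u])
  have f01: "f x \<alpha> \<in> {0..1}" if "x \<in> ?S" "\<alpha> \<in> K" for x \<alpha>
    using cube(3)[OF that(1)] that(2) by (rule PiE_mem)
  have app: "apply_bcontfun (?g y \<alpha>) i = f (y i) \<alpha>" if "y \<in> UNIV \<rightarrow> ?S" "\<alpha> \<in> K" for y \<alpha> i
  proof -
    have "range (\<lambda>i. f (y i) \<alpha>) \<subseteq> {0..1}" using f01 that by blast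
    then have "bounded (range (\<lambda>i. f (y i) \<alpha>))" by (rule bounded_subset[rotated]) simp
    then have "(\<lambda>i. f (y i) \<alpha>) \<in> bcontfun" by (simp add: bcontfun_def)
    then show ?thesis by (simp add: Bcontfun_inverse)
  qed
  \<comment> \<open>A property inherited by smaller entourages may be tested on the basic ones.\<close>
  have base: "(\<exists>U\<in>compact_uniformity X. Q U) \<longleftrightarrow>
      (\<exists>F \<epsilon>. finite F \<and> F \<subseteq> K \<and> \<epsilon> > 0 \<and> Q (?E F \<epsilon>))"
    if mono: "\<And>U V. Q U \<Longrightarrow> V \<subseteq> U \<Longrightarrow> Q V" for Q
    unfolding compact_uniformity_from_coordinates[OF cpt hd cube(1)]
  proof
    assume "\<exists>U\<in>uniformity_from_base ?S (coordinate_entourages ?S K f). Q U"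
    then obtain U F \<epsilon> where U: "Q U" "finite F" "F \<subseteq> K" "\<epsilon> > 0" "?E F \<epsilon> \<subseteq> U"
      unfolding uniformity_from_base_def coordinate_entourages_def by blast
    then show "\<exists>F \<epsilon>. finite F \<and> F \<subseteq> K \<and> \<epsilon> > 0 \<and> Q (?E F \<epsilon>)" using mono[OF U(1,5)] by blast
  next
    assume "\<exists>F \<epsilon>. finite F \<and> F \<subseteq> K \<and> \<epsilon> > 0 \<and> Q (?E F \<epsilon>)"
    then obtain F \<epsilon> where F: "finite F" "F \<subseteq> K" "\<epsilon> > 0" "Q (?E F \<epsilon>)" by blast
    then have "?E F \<epsilon> \<in> coordinate_entourages ?S K f" unfolding coordinate_entourages_def by blast
    then have "?E F \<epsilon> \<in> uniformity_from_base ?S (coordinate_entourages ?S K f)"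
      unfolding uniformity_from_base_def by blast
    then show "\<exists>U\<in>uniformity_from_base ?S (coordinate_entourages ?S K f). Q U" using F(4) by blast
  qed
  show ?thesis
  proof
    fix G
    have *: "(\<exists>W\<in>uniformity_from_base (UNIV \<rightarrow> ?S) (sequence_entourage ?S ` compact_uniformity X). W `` {y} \<subseteq> G)
       \<longleftrightarrow> (\<exists>F \<epsilon>. finite F \<and> F \<subseteq> K \<and> \<epsilon> > 0 \<and>
         (\<forall>y'\<in>topspace ?T. (\<forall>\<alpha>\<in>F. dist (?g y \<alpha>) (?g y' \<alpha>) < \<epsilon>) \<longrightarrow> y' \<in> G))" (is "?l \<longleftrightarrow> ?r")
      if y: "y \<in> UNIV \<rightarrow> ?S" for y
    proof -
      have sub: "sequence_entourage ?S U \<subseteq> (UNIV \<rightarrow> ?S) \<times> (UNIV \<rightarrow> ?S)" for U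
        unfolding sequence_entourage_def by blast
      have "?l \<longleftrightarrow> (\<exists>U\<in>compact_uniformity X. sequence_entourage ?S U `` {y} \<subseteq> G)"
      proof
        assume ?l
        then obtain W U where W: "W `` {y} \<subseteq> G" "U \<in> compact_uniformity X" "sequence_entourage ?S U \<subseteq> W"
          unfolding uniformity_from_base_def by blast
        have "sequence_entourage ?S U `` {y} \<subseteq> W `` {y}" using W(3) by (rule Image_mono) simp
        then show "\<exists>U\<in>compact_uniformity X. sequence_entourage ?S U `` {y} \<subseteq> G" using W(1,2) by blast
      next
        assume "\<exists>U\<in>compact_uniformity X. sequence_entourage ?S U `` {y} \<subseteq> G"
        then obtain U where U: "U \<in> compact_uniformity X" "sequence_entourage ?S U `` {y} \<subseteq> G" by blast
        have "sequence_entourage ?S U \<in>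
            uniformity_from_base (UNIV \<rightarrow> ?S) (sequence_entourage ?S ` compact_uniformity X)"
          unfolding uniformity_from_base_def using sub U(1) by blast
        then show ?l using U(2) by blast
      qed
      also have "\<dots> \<longleftrightarrow> (\<exists>F \<epsilon>. finite F \<and> F \<subseteq> K \<and> \<epsilon> > 0 \<and> sequence_entourage ?S (?E F \<epsilon>) `` {y} \<subseteq> G)"
      proof (rule base)
        fix U V assume UV: "sequence_entourage ?S U `` {y} \<subseteq> G" "V \<subseteq> U"
        have "sequence_entourage ?S V \<subseteq> sequence_entourage ?S U"
          using UV(2) unfolding sequence_entourage_def by blast
        then show "sequence_entourage ?S V `` {y} \<subseteq> G" using UV(1) by blast
      qed
      also have "\<dots> \<longleftrightarrow> ?r"
      proof
        assume "\<exists>F \<epsilon>. finite F \<and> F \<subseteq> K \<and> \<epsilon> > 0 \<and> sequence_entourage ?S (?E F \<epsilon>) `` {y} \<subseteq> G"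
        then obtain F \<epsilon> where F: "finite F" "F \<subseteq> K" "\<epsilon> > 0"
          and G: "sequence_entourage ?S (?E F \<epsilon>) `` {y} \<subseteq> G" by blast
        have "y' \<in> G" if y': "y' \<in> topspace ?T" "\<forall>\<alpha>\<in>F. dist (?g y \<alpha>) (?g y' \<alpha>) < \<epsilon>" for y'
        proof -
          have "\<bar>f (y n) \<alpha> - f (y' n) \<alpha>\<bar> < \<epsilon>" if a: "\<alpha> \<in> F" for n \<alpha>
          proof -
            have "dist (f (y n) \<alpha>) (f (y' n) \<alpha>) \<le> dist (?g y \<alpha>) (?g y' \<alpha>)"
              using dist_bounded[of "?g y \<alpha>" n "?g y' \<alpha>"] app[OF y, of \<alpha> n] app[of y' \<alpha> n] y'(1) topT F(2) a
              by auto
            also have "\<dots> < \<epsilon>" using y'(2) a by blast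
            finally show ?thesis by (simp add: dist_real_def)
          qed
          then have "(y, y') \<in> sequence_entourage ?S (?E F \<epsilon>)"
            using y y'(1) unfolding topT sequence_entourage_def by blast
          then show ?thesis using G by blast
        qed
        then show ?r using F by blast
      next
        assume ?r
        then obtain F \<epsilon> where F: "finite F" "F \<subseteq> K" "\<epsilon> > 0"
          and G: "\<forall>y'\<in>topspace ?T. (\<forall>\<alpha>\<in>F. dist (?g y \<alpha>) (?g y' \<alpha>) < \<epsilon>) \<longrightarrow> y' \<in> G" by blast
        have "y' \<in> G" if yy: "(y, y') \<in> sequence_entourage ?S (?E F (\<epsilon> / 2))" for y'
        proof -
          have y': "y' \<in> UNIV \<rightarrow> ?S" using yy unfolding sequence_entourage_def by blast
          have "dist (?g y \<alpha>) (?g y' \<alpha>) < \<epsilon>" if a: "\<alpha> \<in> F" for \<alpha>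
          proof -
            have aK: "\<alpha> \<in> K" using a F(2) by blast
            have "\<bar>f (y n) \<alpha> - f (y' n) \<alpha>\<bar> < \<epsilon> / 2" for n
              using yy a unfolding sequence_entourage_def by blast
            then have "dist (?g y \<alpha>) (?g y' \<alpha>) \<le> \<epsilon> / 2"
              by (intro dist_bound) (simp add: app[OF y aK] app[OF y' aK] dist_real_def less_imp_le)
            then show ?thesis using F(3) by simp
          qed
          then show ?thesis using G y' unfolding topT by blast
        qed
        then have "sequence_entourage ?S (?E F (\<epsilon> / 2)) `` {y} \<subseteq> G" by blast
        moreover have "\<epsilon> / 2 > 0" using F(3) by simp
        ultimately show "\<exists>F \<epsilon>. finite F \<and> F \<subseteq> K \<and> \<epsilon> > 0 \<and> sequence_entourage ?S (?E F \<epsilon>) `` {y} \<subseteq> G"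
          using F(1,2) by blast
      qed
      finally show ?thesis .
    qed
    have "openin ?T G \<longleftrightarrow> G \<subseteq> (UNIV \<rightarrow> ?S) \<and>
       (\<forall>y\<in>G. \<exists>W\<in>uniformity_from_base (UNIV \<rightarrow> ?S) (sequence_entourage ?S ` compact_uniformity X). W `` {y} \<subseteq> G)"
      unfolding T by (rule openin_uniform_topology[OF u])
    also have "\<dots> \<longleftrightarrow> G \<subseteq> topspace ?T \<and> (\<forall>y\<in>G. \<exists>F \<epsilon>. finite F \<and> F \<subseteq> K \<and> \<epsilon> > 0 \<and>
         (\<forall>y'\<in>topspace ?T. (\<forall>\<alpha>\<in>F. dist (?g y \<alpha>) (?g y' \<alpha>) < \<epsilon>) \<longrightarrow> y' \<in> G))"
      unfolding topT by (intro conj_cong ball_cong refl *[unfolded topT]) (rule subsetD)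
    finally show "openin ?T G \<longleftrightarrow> G \<subseteq> topspace ?T \<and> (\<forall>y\<in>G. \<exists>F \<epsilon>. finite F \<and> F \<subseteq> K \<and> \<epsilon> > 0 \<and>
         (\<forall>y'\<in>topspace ?T. (\<forall>\<alpha>\<in>F. dist (?g y \<alpha>) (?g y' \<alpha>) < \<epsilon>) \<longrightarrow> y' \<in> G))" .
  next
    fix y y' assume y: "y \<in> topspace ?T" "y' \<in> topspace ?T"
      and eq: "\<And>\<alpha>. \<alpha> \<in> K \<Longrightarrow> ?g y \<alpha> = ?g y' \<alpha>"
    show "y = y'"
    proof
      fix n
      have S: "y n \<in> ?S" "y' n \<in> ?S" using y unfolding topT by auto
      have "f (y n) \<alpha> = f (y' n) \<alpha>" if "\<alpha> \<in> K" for \<alpha>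
        using app[of y \<alpha> n] app[of y' \<alpha> n] eq[OF that] y that unfolding topT by simp
      then have "f (y n) = f (y' n)" using cube(3)[OF S(1)] cube(3)[OF S(2)] by (intro PiE_ext)
      then show "y n = y' n" using cube(4) S by (auto dest: inj_onD)
    qed
  next
    fix y assume "y \<in> topspace ?T"
    then have y: "y \<in> UNIV \<rightarrow> ?S" unfolding topT .
    have "{\<alpha>\<in>K. ?g y \<alpha> \<noteq> 0} \<subseteq> (\<Union>n. {\<alpha>\<in>K. f (y n) \<alpha> \<noteq> 0})"
    proof
      fix \<alpha> assume a: "\<alpha> \<in> {\<alpha>\<in>K. ?g y \<alpha> \<noteq> 0}"
      then obtain n where "apply_bcontfun (?g y \<alpha>) n \<noteq> apply_bcontfun 0 n"
        using bcontfun_eqI[of "?g y \<alpha>" 0] by blast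
      then show "\<alpha> \<in> (\<Union>n. {\<alpha>\<in>K. f (y n) \<alpha> \<noteq> 0})" using a app[OF y, of \<alpha> n] by auto
    qed
    moreover have "countable (\<Union>n. {\<alpha>\<in>K. f (y n) \<alpha> \<noteq> 0})"
      using cube(2) y by (intro countable_UN) auto
    ultimately show "countable {\<alpha>\<in>K. ?g y \<alpha> \<noteq> 0}" by (rule countable_subset)
  next
    fix p :: "nat \<Rightarrow> nat \<Rightarrow> 'a" and w
    assume "\<And>n. p n \<in> topspace ?T" and lim: "\<And>\<alpha>. \<alpha> \<in> K \<Longrightarrow> (\<lambda>n. ?g (p n) \<alpha>) \<longlonglongrightarrow> w \<alpha>"
    then have p: "p n \<in> UNIV \<rightarrow> ?S" for n unfolding topT by blast
    have "f ` ?S \<subseteq> topspace ?P" using cube(3) by (auto simp: topspace_product_topology)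
    have "compactin X ?S" using cpt by (simp add: compact_space_def)
    moreover have "continuous_map X ?P f"
      using homeomorphic_imp_continuous_map[OF hom] by (simp add: continuous_map_in_subtopology)
    ultimately have "compactin ?P (f ` ?S)" by (rule image_compactin)
    moreover have "Hausdorff_space ?P"
      by (simp add: Hausdorff_space_product_topology Hausdorff_space_subtopology)
    ultimately have clo: "closedin ?P (f ` ?S)" by (intro compactin_imp_closedin)
    have "\<exists>a\<in>?S. \<forall>\<alpha>\<in>K. f a \<alpha> = apply_bcontfun (w \<alpha>) i" for i
    proof -
      define l where "l = restrict (\<lambda>\<alpha>. apply_bcontfun (w \<alpha>) i) K"
      have S: "p n i \<in> ?S" for n using p by blast
      have *: "(\<lambda>n. f (p n i) \<alpha>) \<longlonglongrightarrow> l \<alpha>" if a: "\<alpha> \<in> K" for \<alpha>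
      proof -
        have "(\<lambda>n. apply_bcontfun (?g (p n) \<alpha>) i) \<longlonglongrightarrow> apply_bcontfun (w \<alpha>) i"
        proof (rule metric_tendsto_imp_tendsto[OF lim[OF a]])
          show "\<forall>\<^sub>F n in sequentially. dist (apply_bcontfun (?g (p n) \<alpha>) i) (apply_bcontfun (w \<alpha>) i)
              \<le> dist (?g (p n) \<alpha>) (w \<alpha>)" by (intro always_eventually allI dist_bounded)
        qed
        then show ?thesis using a by (simp add: app[OF p a] l_def)
      qed
      have "limitin ?P (\<lambda>n. f (p n i)) l sequentially"
        unfolding limitin_componentwise
      proof (intro conjI ballI)
        show "l \<in> extensional K" by (simp add: l_def)
        show "\<forall>\<^sub>F n in sequentially. f (p n i) \<in> topspace ?P"
          using cube(3)[OF S] by (intro always_eventually) (simp add: topspace_product_topology)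
        fix \<alpha> assume a: "\<alpha> \<in> K"
        have "l \<alpha> \<in> {0..1}"
          by (rule closed_sequentially[OF closed_atLeastAtMost _ *[OF a]]) (use f01[OF S a] in simp)
        then show "limitin (top_of_set {0..1}) (\<lambda>n. f (p n i) \<alpha>) (l \<alpha>) sequentially"
          unfolding limitin_subtopology using *[OF a] f01[OF S a] by (simp add: limitin_canonical_iff)
      qed
      then have "l \<in> f ` ?S"
        by (rule limitin_closedin[OF _ clo]) (use S in auto)
      then obtain a where "a \<in> ?S" "l = f a" by blast
      moreover have "l \<alpha> = apply_bcontfun (w \<alpha>) i" if "\<alpha> \<in> K" for \<alpha> using that by (simp add: l_def)
      ultimately show ?thesis by metis
    qed
    then obtain z where z: "\<And>i. z i \<in> ?S" "\<And>i \<alpha>. \<alpha> \<in> K \<Longrightarrow> f (z i) \<alpha> = apply_bcontfun (w \<alpha>) i"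
      by metis
    have zP: "z \<in> UNIV \<rightarrow> ?S" using z(1) by blast
    have "?g z \<alpha> = w \<alpha>" if "\<alpha> \<in> K" for \<alpha>
      using z(2)[OF that] by (simp add: apply_bcontfun_inverse)
    then show "\<exists>z\<in>topspace ?T. \<forall>\<alpha>\<in>K. ?g z \<alpha> = w \<alpha>" using zP unfolding topT by blast
  qed
qed

theorem mainTheorem2:
  fixes X :: "'a topology"
  assumes "Corson_compactum TYPE('k) X"
  shows "collectionwise_normal_space (countable_uniform_power X) \<and>
         countably_paracompact_space (countable_uniform_power X) \<and>
         Frechet_Urysohn_space (countable_uniform_power X)"
proof -
  obtain K :: "'k set" and f where X: "compact_space X" "Hausdorff_space X"
    and emb: "embedding_map X (Sigma_product_interval K) f"
    using assms unfolding Corson_compactum_def by blast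
  interpret sigma_closed_space "countable_uniform_power X" K
      "\<lambda>y \<alpha>. Bcontfun (\<lambda>i. f (y i) \<alpha>) :: nat \<Rightarrow>\<^sub>C real" "\<lambda>_. 0"
    using X emb by (rule countable_uniform_power_sigma_closed)
  show ?thesis
    using collectionwise_normal countably_paracompact Frechet_Urysohn by blast
qed

end
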